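(* For $\beta\in[-\frac{\pi}{7},\frac{\pi}{7}]$ let $$J_\beta=\left[-\tfrac{32\pi}{7},\,-4\pi+4\beta\right)\cup\left[-\pi+\beta,\,-\tfrac{4\pi}{7}\right)\cup\left[\tfrac{4\pi}{7},\,\pi+\beta\right)\cup\left[4\pi+4\beta,\,4\pi+\tfrac{4\pi}{7}\right),$$ which is a wavelet set. Then for all $\beta_1,\beta_2\in[-\frac{\pi}{7},\frac{\pi}{7}]$ the pair $(J_{\beta_1},J_{\beta_2})$ is an interpolation pair of wavelet sets; that is, the interpolation map $\sigma=\sigma_{J_{\beta_1}}^{J_{\beta_2}}:\mathbb{R}\to\mathbb{R}$ satisfies $\sigma\circ\sigma=\mathrm{id}$.
   Context: A wavelet set is a measurable set $E\subseteq\mathbb{R}$ such that $\frac{1}{\sqrt{2\pi}}\chi_E$ is the Fourier transform of a dyadic orthonormal wavelet (a unit vector $\psi\in L^2(\mathbb{R})$ for which $\{2^{n/2}\psi(2^nt-l):n,l\in\mathbb{Z}\}$ is an orthonormal basis of $L^2(\mathbb{R})$), where the Fourier transform is $\hat f(s)=\frac{1}{\sqrt{2\pi}}\int_{\mathbb{R}}e^{-ist}f(t)\,dt$. Equivalently, both $\{E+2\pi n\}_{n\in\mathbb{Z}}$ and $\{2^nE\}_{n\in\mathbb{Z}}$ are measurable partitions (modulo null sets) of $\mathbb{R}$. Interpolation map: for wavelet sets $E,F$, for (a.e.) $x\in E$ there is a unique $y\in F$ with $x-y\in 2\pi\mathbb{Z}$; set $\sigma(x)=y$. This gives a bijection $\sigma:E\to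 F$ (modulo null sets). It is extended to $\mathbb{R}$ by $\sigma(0)=0$ and $\sigma(s)=2^n\sigma(2^{-n}s)$ for $s\in 2^nE$, $n\in\mathbb{Z}$. The resulting map is denoted $\sigma_E^F$ and called the interpolation map for the ordered pair $(E,F)$. A pair $(E,F)$ of wavelet sets is called an interpolation pair if $\sigma_E^F$ is an involution, i.e. $\sigma_E^F\circ\sigma_E^F$ is the identity map of $\mathbb{R}$. (Maps are understood modulo null sets.) *)

theory Defs
  imports "HOL-Analysis.Analysis"
begin

definition L2_fun :: "(real \<Rightarrow> complex) set" where
  "L2_fun = {f. f \<in> borel_measurable lebesgue \<and> integrable lebesgue (\<lambda>t. (cmod (f t))\<^sup>2)}"

definition L2_inner :: "(real \<Rightarrow> complex) \<Rightarrow> (real \<Rightarrow> complex) \<Rightarrow> complex" where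
  "L2_inner f g = (LINT t|lebesgue. f t * cnj (g t))"

definition L2_norm :: "(real \<Rightarrow> complex) \<Rightarrow> real" where
  "L2_norm f = sqrt (LINT t|lebesgue. (cmod (f t))\<^sup>2)"

text \<open>
  The elements are functions rather than classes modulo null sets, so density of the linear span
  is stated as approximation in the seminorm.
\<close>

definition orthonormal_basis_L2 :: "('i \<Rightarrow> real \<Rightarrow> complex) \<Rightarrow> bool" where
  "orthonormal_basis_L2 e \<longleftrightarrow>
     (\<forall>i. e i \<in> L2_fun) \<and>
     (\<forall>i j. L2_inner (e i) (e j) = (if i = j then 1 else 0)) \<and>
     (\<forall>f\<in>L2_fun. \<forall>\<epsilon>>0. \<exists>I c. finite I \<and> L2_norm (\<lambda>t. f t - (\<Sum>i\<in>I. c i * e i t)) < \<epsilon>)"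

definition dyadic_family :: "(real \<Rightarrow> complex) \<Rightarrow> int \<times> int \<Rightarrow> real \<Rightarrow> complex" where
  "dyadic_family \<psi> = (\<lambda>(n, l) t.
     complex_of_real (2 powr (real_of_int n / 2)) * \<psi> (2 powi n * t - real_of_int l))"

definition orthonormal_wavelet :: "(real \<Rightarrow> complex) \<Rightarrow> bool" where
  "orthonormal_wavelet \<psi> \<longleftrightarrow>
     \<psi> \<in> L2_fun \<and> L2_norm \<psi> = 1 \<and> orthonormal_basis_L2 (dyadic_family \<psi>)"

definition truncated_fourier :: "real \<Rightarrow> (real \<Rightarrow> complex) \<Rightarrow> real \<Rightarrow> complex" where
  "truncated_fourier R f s =
     complex_of_real (1 / sqrt (2 * pi)) *
     (LINT t:{-R..R}|lebesgue. exp (- (\<i> * complex_of_real (s * t))) * f t)"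

text \<open>
  \<open>L2_fourier f g\<close>: the class of \<open>g\<close> is the Fourier transform of \<open>f\<close>. The integral formula is
  literal only for integrable \<open>f\<close>; on \<open>L\<^sup>2\<close> the transform is the continuous extension from
  \<open>L\<^sup>1 \<inter> L\<^sup>2\<close>, evaluated here along the cut-offs of \<open>f\<close> to \<open>[-R, R]\<close>, which are in \<open>L\<^sup>1 \<inter> L\<^sup>2\<close>
  and converge to \<open>f\<close> in \<open>L\<^sup>2\<close>. The nonnegative integral is used because, unlike the Bochner
  integral, it does not vanish by convention on non-square-integrable differences.
\<close>

definition L2_fourier :: "(real \<Rightarrow> complex) \<Rightarrow> (real \<Rightarrow> complex) \<Rightarrow> bool" where
  "L2_fourier f g \<longleftrightarrow>
     f \<in> L2_fun \<and> g \<in> L2_fun \<and>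
     ((\<lambda>R. \<integral>\<^sup>+ s. ennreal ((cmod (truncated_fourier R f s - g s))\<^sup>2) \<partial>lebesgue) \<longlongrightarrow> 0) at_top"

definition wavelet_set :: "real set \<Rightarrow> bool" where
  "wavelet_set E \<longleftrightarrow>
     E \<in> sets lebesgue \<and>
     (\<exists>\<psi>. orthonormal_wavelet \<psi> \<and>
          L2_fourier \<psi> (\<lambda>s. complex_of_real (1 / sqrt (2 * pi) * indicator E s)))"

text \<open>
  For wavelet sets \<open>E\<close> and \<open>F\<close> the two descriptions below determine a unique object for almost
  every argument; on the exceptional null set the values of the interpolation map are arbitrary.
\<close>

definition translation_rep :: "real set \<Rightarrow> real \<Rightarrow> real" where
  "translation_rep F x = (THE y. y \<in> F \<and> (\<exists>k::int. x - y = 2 * pi * real_of_int k))"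

definition dilation_exponent :: "real set \<Rightarrow> real \<Rightarrow> int" where
  "dilation_exponent E s = (THE n. s \<in> (\<lambda>x. 2 powi n * x) ` E)"

definition interpolation_map :: "real set \<Rightarrow> real set \<Rightarrow> real \<Rightarrow> real" where
  "interpolation_map E F s =
     (if s = 0 then 0
      else 2 powi dilation_exponent E s *
           translation_rep F (2 powi (- dilation_exponent E s) * s))"

definition interpolation_pair :: "real set \<Rightarrow> real set \<Rightarrow> bool" where
  "interpolation_pair E F \<longleftrightarrow>
     wavelet_set E \<and> wavelet_set F \<and>
     (AE s in lebesgue. (interpolation_map E F \<circ> interpolation_map E F) s = s)"

definition J :: "real \<Rightarrow> real set" where
  "J \<beta> = {- (32 * pi / 7) ..< - 4 * pi + 4 * \<beta>} \<union>
         {- pi + \<beta> ..< - (4 * pi / 7)} \<union>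
         {4 * pi / 7 ..< pi + \<beta>} \<union>
         {4 * pi + 4 * \<beta> ..< 4 * pi + 4 * pi / 7}"

end

theory Submission
  imports Defs "HOL-Probability.Characteristic_Functions"
begin

text \<open>
Why the theorem holds. Write \<open>E = J \<beta>\<^sub>1\<close> and \<open>F = J \<beta>\<^sub>2\<close>, and suppose first that
\<open>\<beta>\<^sub>1 < \<beta>\<^sub>2\<close>. The points of \<open>E\<close> outside \<open>F\<close> form the two intervals
\<open>A = [-\<pi> + \<beta>\<^sub>1, -\<pi> + \<beta>\<^sub>2)\<close> and \<open>B = [4\<pi> + 4\<beta>\<^sub>1, 4\<pi> + 4\<beta>\<^sub>2)\<close>. The interpolation map
moves \<open>A\<close> by \<open>2\<pi>\<close> onto \<open>B / 4\<close> and moves \<open>B\<close> by \<open>-8\<pi>\<close> onto \<open>4A\<close>. It commutes with dilations by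
powers of two, so it moves \<open>B / 4\<close> by \<open>-2\<pi>\<close> and \<open>4A\<close> by \<open>8\<pi>\<close>, and the second application undoes
the first. For \<open>\<beta>\<^sub>2 < \<beta>\<^sub>1\<close> the picture is mirrored. This is lemma \<open>J_interpolation_step\<close>.

Most of the work is to show that \<open>J \<beta>\<close> is a wavelet set in the sense of the definition, that is,
that an actual orthonormal basis of \<open>L\<^sup>2\<close> arises. The set \<open>J \<beta>\<close> meets every coset of \<open>2\<pi>\<int>\<close> in
exactly one point and every orbit \<open>{2^n s}\<close>, \<open>s \<noteq> 0\<close>, in exactly one point, and theorem
\<open>wavelet_set_tile\<close> shows that a Borel set with these two properties, with a null frontier and
not containing zero is a wavelet set. On the frequency side the reason is simple: because of the first property the
exponentials \<open>e^{-ilx}\<close> restricted to \<open>E\<close> are a complete orthogonal system of \<open>L\<^sup>2(E)\<close>, as they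
are for an interval of length \<open>2\<pi>\<close>, and because of the second one \<open>L\<^sup>2(\<real>)\<close> is the orthogonal sum
of the spaces \<open>L\<^sup>2(2^n E)\<close>.

Plancherel's theorem carries this over to the time side. It is proved here for bounded integrable
functions that are continuous almost everywhere (\<open>test_function\<close>). That class suffices: it
contains the exponentials restricted to the sets \<open>2^n E\<close>, and if \<open>h\<close> belongs to it then so do the
cut-offs of the Fourier integral of \<open>h\<close> to bounded intervals. Hence the \<open>L\<^sup>2\<close> inversion formula
(\<open>Fourier_inversion_L2\<close>) follows by expanding a square, and with it the density in \<open>L\<^sup>2\<close> of the
Fourier integrals of test functions (\<open>Fourier_images_dense\<close>).
\<close>

section \<open>The Fourier integral of an integrable function\<close>

text \<open>
With the symmetric normalisation the inverse transform is \<open>\<lambda>t. fourier h (- t)\<close>, so that one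
definition serves both directions.
\<close>

definition fourier :: "(real \<Rightarrow> complex) \<Rightarrow> real \<Rightarrow> complex" where
  "fourier h t = complex_of_real (1 / sqrt (2 * pi)) * (LINT s|lborel. cis (- (s * t)) * h s)"

lemma measurable_cis [measurable]: "cis \<in> borel_measurable borel"
  by (intro borel_measurable_continuous_onI continuous_on_cis continuous_on_id)

lemma measurable_cis_comp [measurable (raw)]:
  "f \<in> borel_measurable M \<Longrightarrow> (\<lambda>x. cis (f x)) \<in> borel_measurable M"
  by (rule measurable_compose[OF _ measurable_cis])

lemma measurable_cnj [measurable]: "cnj \<in> borel_measurable borel"
  by (intro borel_measurable_continuous_onI continuous_intros)

lemma integrable_cis_mult:
  assumes "integrable M h" "f \<in> borel_measurable M"
  shows "integrable M (\<lambda>s. cis (f s) * h s)"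
proof (rule Bochner_Integration.integrable_bound[OF assms(1)])
  show "(\<lambda>s. cis (f s) * h s) \<in> borel_measurable M"
    using assms by measurable
qed (simp add: norm_mult)

lemma fourier_bounded:
  assumes "integrable lborel h"
  shows "norm (fourier h t) \<le> (LINT s|lborel. norm (h s)) / sqrt (2 * pi)"
proof -
  have "norm (LINT s|lborel. cis (- (s * t)) * h s) \<le> (LINT s|lborel. norm (cis (- (s * t)) * h s))"
    by (rule integral_norm_bound)
  then show ?thesis by (simp add: fourier_def norm_mult norm_divide divide_right_mono)
qed

lemma isCont_fourier:
  assumes h: "integrable lborel h"
  shows "isCont (fourier h) t"
proof -
  have [measurable]: "h \<in> borel_measurable lborel" using h by simp
  have "(\<lambda>n. fourier h (x n)) \<longlonglongrightarrow> fourier h t" if "x \<longlonglongrightarrow> t" for x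
    unfolding fourier_def
  proof (intro tendsto_mult tendsto_const integral_dominated_convergence[where w = "\<lambda>s. norm (h s)"])
    show "AE s in lborel. (\<lambda>n. cis (- (s * x n)) * h s) \<longlonglongrightarrow> cis (- (s * t)) * h s"
      using that unfolding cis_conv_exp by (intro AE_I2 tendsto_intros)
  qed (use h in \<open>auto simp: norm_mult\<close>)
  then show ?thesis by (simp add: continuous_at_sequentially o_def)
qed

lemma measurable_fourier [measurable]:
  assumes "integrable lborel h"
  shows "fourier h \<in> borel_measurable borel"
  by (intro borel_measurable_continuous_onI continuous_at_imp_continuous_on ballI isCont_fourier assms)

text \<open>
Fubini's theorem; this identity is the only interchange of integrals in the proof of Plancherel's
theorem and of the inversion formula.
\<close>

lemma fourier_duality:
  assumes h: "integrable lborel h" and v: "integrable lborel v"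
  shows "(LINT t|lborel. fourier h t * v t) = (LINT s|lborel. h s * fourier v s)"
proof -
  have [measurable]: "h \<in> borel_measurable borel" "v \<in> borel_measurable borel" using h v by auto
  let ?f = "\<lambda>s t. cis (- (s * t)) * h s * v t"
  have "integrable (lborel \<Otimes>\<^sub>M lborel) (case_prod ?f)"
  proof (rule lborel_pair.Fubini_integrable)
    show "integrable lborel (\<lambda>x. LINT y|lborel. norm (case (x, y) of (s, t) \<Rightarrow> ?f s t))"
      using h by (simp add: norm_mult)
    show "AE x in lborel. integrable lborel (\<lambda>y. case (x, y) of (s, t) \<Rightarrow> ?f s t)"
    proof (rule AE_I2)
      fix x
      have "integrable lborel (\<lambda>y. cis (- (x * y)) * (h x * v y))"
        by (intro integrable_cis_mult integrable_mult_right v) auto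
      then show "integrable lborel (\<lambda>y. case (x, y) of (s, t) \<Rightarrow> ?f s t)"
        by (simp add: mult.assoc)
    qed
  qed measurable
  from lborel_pair.Fubini_integral[OF this]
  have eq: "(LINT t|lborel. LINT s|lborel. ?f s t) = (LINT s|lborel. LINT t|lborel. ?f s t)" .
  let ?c = "complex_of_real (1 / sqrt (2 * pi))"
  have "(LINT t|lborel. fourier h t * v t) = ?c * (LINT t|lborel. LINT s|lborel. ?f s t)"
    unfolding fourier_def by (simp add: mult.assoc flip: integral_mult_left_zero)
  also have "\<dots> = ?c * (LINT s|lborel. LINT t|lborel. h s * (cis (- (t * s)) * v t))"
    unfolding eq by (simp add: mult_ac)
  also have "\<dots> = (LINT s|lborel. ?c * (h s * (LINT t|lborel. cis (- (t * s)) * v t)))"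
    by simp
  also have "\<dots> = (LINT s|lborel. h s * fourier v s)"
    by (intro Bochner_Integration.integral_cong) (simp_all add: fourier_def algebra_simps)
  finally show ?thesis .
qed

lemma cnj_fourier: "cnj (fourier h t) = fourier (\<lambda>s. cnj (h s)) (- t)"
  by (simp add: fourier_def cis_cnj del: Bochner_Integration.integral_cnj flip: Bochner_Integration.integral_cnj)

section \<open>Plancherel's theorem by Gaussian regularisation\<close>

lemma integrable_gauss:
  assumes "0 < \<epsilon>"
  shows "integrable lborel (\<lambda>t. exp (- (\<epsilon> * t)\<^sup>2 / 2) :: real)"
proof -
  have "integrable lborel (\<lambda>t. std_normal_density t)"
    by (rule integrable_normal_density) simp
  then have "integrable lborel (\<lambda>t. sqrt (2 * pi) * std_normal_density (0 + \<epsilon> * t))"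
    using assms by (intro integrable_mult_right lborel_integrable_real_affine) auto
  then show ?thesis by (simp add: std_normal_density_def)
qed

text \<open>
A rescaling of the fact that the standard normal density is, up to a constant, its own
characteristic function.
\<close>

lemma fourier_gauss:
  assumes "0 < \<epsilon>"
  shows "fourier (\<lambda>t. complex_of_real (exp (- (\<epsilon> * t)\<^sup>2 / 2))) x = exp (- (x / \<epsilon>)\<^sup>2 / 2) / \<epsilon>"
proof -
  have "complex_of_real (exp (- (- x / \<epsilon>)\<^sup>2 / 2)) = char std_normal_distribution (- x / \<epsilon>)"
    by (simp add: char_std_normal_distribution)
  also have "\<dots> = (LINT y|lborel. std_normal_density y *\<^sub>R cis (- x / \<epsilon> * y))"
    unfolding char_def by (subst integral_density) (auto simp: cis_conv_exp)
  also have "\<dots> = \<epsilon> *\<^sub>R (LINT y|lborel. std_normal_density (\<epsilon> * y) *\<^sub>R cis (- (y * x)))"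
    using assms by (subst lborel_integral_real_affine[of \<epsilon> _ 0]) (auto simp: field_simps)
  also have "\<dots> = \<epsilon> *\<^sub>R fourier (\<lambda>t. complex_of_real (exp (- (\<epsilon> * t)\<^sup>2 / 2))) x"
    unfolding fourier_def std_normal_density_def
    by (simp add: scaleR_conv_of_real mult_ac flip: integral_mult_right_zero)
  finally show ?thesis using assms by (simp add: scaleR_conv_of_real field_simps)
qed

text \<open>
Continuity almost everywhere is what makes averages of \<open>h\<close> over shrinking Gaussians converge to \<open>h\<close>
almost everywhere, by dominated convergence.
\<close>

definition test_function :: "(real \<Rightarrow> complex) \<Rightarrow> bool" where
  "test_function h \<longleftrightarrow> integrable lborel h \<and> bounded (range h) \<and> (AE x in lborel. isCont h x)"

lemma test_function_integrable [simp]: "test_function h \<Longrightarrow> integrable lborel h"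
  by (simp add: test_function_def)

lemma test_function_measurable [measurable_dest]: "test_function h \<Longrightarrow> h \<in> borel_measurable borel"
  using borel_measurable_integrable[OF test_function_integrable] by auto

lemma test_function_boundE:
  assumes "test_function h" obtains M where "\<And>x. norm (h x) \<le> M" "0 \<le> M"
proof -
  from assms obtain M where M: "\<And>x. norm (h x) \<le> M"
    unfolding test_function_def bounded_iff by auto
  moreover have "0 \<le> M" using norm_ge_zero M order_trans by blast
  ultimately show ?thesis using that by blast
qed

lemma integrable_norm_mult_bounded:
  fixes h k :: "real \<Rightarrow> complex"
  assumes h: "integrable M h" and k: "k \<in> borel_measurable M" "\<And>x. norm (k x) \<le> C"
  shows "integrable M (\<lambda>x. h x * k x)"
proof (rule Bochner_Integration.integrable_bound[of _ "\<lambda>x. C * norm (h x)"])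
  show "integrable M (\<lambda>x. C * norm (h x))" using h by auto
  show "(\<lambda>x. h x * k x) \<in> borel_measurable M" using h k by measurable
  show "AE x in M. norm (h x * k x) \<le> norm (C * norm (h x))"
  proof (rule AE_I2)
    fix x
    have "norm (h x * k x) \<le> norm (h x) * C"
      by (simp add: norm_mult mult_left_mono k)
    then show "norm (h x * k x) \<le> norm (C * norm (h x))" by (simp add: mult.commute)
  qed
qed

lemma test_function_square_integrable:
  assumes "test_function h"
  shows "integrable lborel (\<lambda>x. (norm (h x))\<^sup>2)"
proof -
  obtain M where M: "\<And>x. norm (h x) \<le> M" using assms by (rule test_function_boundE) blast
  have "integrable lborel (\<lambda>x. h x * cnj (h x))"
    by (rule integrable_norm_mult_bounded[where C = M]) (use assms M in auto)
  from integrable_norm[OF this] show ?thesis by (simp add: norm_mult power2_eq_square)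
qed

text \<open>
Multiplying by a wide Gaussian on the frequency side averages over a narrow Gaussian on the other
side: two applications of duality move the Fourier integral onto the Gaussian.
\<close>

lemma fourier_gaussian_cutoff:
  assumes k: "integrable lborel k" and \<epsilon>: "0 < \<epsilon>"
  shows "fourier (\<lambda>t. cnj (fourier k t) * exp (- (\<epsilon> * t)\<^sup>2 / 2)) s =
    (LINT u|lborel. cnj (k (s + \<epsilon> * u)) * std_normal_density u)"
proof -
  let ?G = "\<lambda>t. complex_of_real (exp (- (\<epsilon> * t)\<^sup>2 / 2))"
  let ?c = "complex_of_real (1 / sqrt (2 * pi))"
  have [measurable]: "k \<in> borel_measurable borel" using k by auto
  have G: "integrable lborel ?G"
    using integrable_gauss[OF \<epsilon>] by (rule integrable_of_real)
  have shift: "fourier (\<lambda>t. cis (t * s) * ?G t) x = exp (- ((x - s) / \<epsilon>)\<^sup>2 / 2) / \<epsilon>" for x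
  proof -
    have "fourier (\<lambda>t. cis (t * s) * ?G t) x = fourier ?G (x - s)"
      unfolding fourier_def mult.assoc[symmetric] cis_mult by (simp add: algebra_simps)
    then show ?thesis using fourier_gauss[OF \<epsilon>] by simp
  qed
  have "fourier (\<lambda>t. cnj (fourier k t) * ?G t) s =
      ?c * (LINT t|lborel. fourier (\<lambda>x. cnj (k x)) (- t) * (cis (- t * s) * ?G (- t)))"
    by (subst fourier_def) (simp add: cnj_fourier mult_ac)
  also have "\<dots> = ?c * (LINT t|lborel. fourier (\<lambda>x. cnj (k x)) t * (cis (t * s) * ?G t))"
    by (subst (2) lborel_integral_real_affine[of "-1" _ 0]) simp_all
  also have "\<dots> = ?c * (LINT x|lborel. cnj (k x) * fourier (\<lambda>t. cis (t * s) * ?G t) x)"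
    by (subst fourier_duality) (use k G in \<open>auto intro!: integrable_cis_mult\<close>)
  also have "\<dots> = ?c * (LINT x|lborel. cnj (k x) * (exp (- ((x - s) / \<epsilon>)\<^sup>2 / 2) / \<epsilon>))"
    by (simp only: shift)
  also have "\<dots> = ?c * (LINT u|lborel. cnj (k (s + \<epsilon> * u)) * exp (- u\<^sup>2 / 2))"
    using \<epsilon> by (subst lborel_integral_real_affine[of \<epsilon> _ s]) (auto simp: scaleR_conv_of_real)
  also have "\<dots> = (LINT u|lborel. cnj (k (s + \<epsilon> * u)) * std_normal_density u)"
    by (simp add: std_normal_density_def mult_ac flip: integral_mult_right_zero)
  finally show ?thesis .
qed

lemma gaussian_average_tendsto:
  fixes k :: "real \<Rightarrow> complex"
  assumes k: "k \<in> borel_measurable borel" "\<And>x. norm (k x) \<le> M" and s: "isCont k s"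
    and \<epsilon>: "\<epsilon> \<longlonglongrightarrow> 0"
  shows "(\<lambda>n::nat. LINT u|lborel. k (s + \<epsilon> n * u) * std_normal_density u) \<longlonglongrightarrow> k s"
proof -
  note k(1)[measurable]
  have "(\<lambda>n::nat. LINT u|lborel. k (s + \<epsilon> n * u) * std_normal_density u) \<longlonglongrightarrow>
    (LINT u|lborel. k s * std_normal_density u)"
  proof (rule integral_dominated_convergence[where w = "\<lambda>u. M * std_normal_density u"])
    show "AE u in lborel. (\<lambda>n. k (s + \<epsilon> n * u) * std_normal_density u) \<longlonglongrightarrow> k s * std_normal_density u"
    proof (intro AE_I2 tendsto_mult tendsto_const)
      fix u
      have "(\<lambda>n. s + \<epsilon> n * u) \<longlonglongrightarrow> s + 0 * u"
        by (intro tendsto_intros \<epsilon>)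
      then show "(\<lambda>n. k (s + \<epsilon> n * u)) \<longlonglongrightarrow> k s"
        using s isCont_tendsto_compose by fastforce
    qed
    show "AE u in lborel. norm (k (s + \<epsilon> n * u) * complex_of_real (std_normal_density u))
        \<le> M * std_normal_density u" for n
      by (intro AE_I2) (simp add: norm_mult mult_right_mono k)
  qed (auto intro!: integrable_mult_right integrable_normal_density)
  also have "(LINT u|lborel. k s * std_normal_density u) = k s"
    by (simp add: integral_complex_of_real[of _ std_normal_density, simplified])
  finally show ?thesis .
qed

text \<open>
The Gaussian factor makes the left-hand integrals absolutely convergent, so that duality applies
before anything is known about square integrability of the Fourier integrals.
\<close>

lemma regularised_Parseval:
  assumes h: "integrable lborel h" and k: "test_function k"
  shows "(\<lambda>n. LINT t|lborel. fourier h t * cnj (fourier k t) * exp (- (inverse (real (Suc n)) * t)\<^sup>2 / 2)) \<longlonglongrightarrow>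
    (LINT s|lborel. h s * cnj (k s))"
proof -
  have [measurable]: "k \<in> borel_measurable borel" using k by (rule test_function_measurable)
  obtain M where M: "\<And>x. norm (k x) \<le> M" "0 \<le> M" using k by (rule test_function_boundE) blast
  have [measurable]: "fourier k \<in> borel_measurable borel" using k by simp
  have [measurable]: "h \<in> borel_measurable borel" using h by auto
  let ?e = "\<lambda>n. inverse (real (Suc n))"
  let ?A = "\<lambda>n s. LINT u|lborel. cnj (k (s + ?e n * u)) * complex_of_real (std_normal_density u)"
  have "(LINT t|lborel. fourier h t * cnj (fourier k t) * exp (- (?e n * t)\<^sup>2 / 2)) = (LINT s|lborel. h s * ?A n s)" for n
  proof -
    have pos: "0 < ?e n" by simp
    have "integrable lborel (\<lambda>t. complex_of_real (exp (- (?e n * t)\<^sup>2 / 2)) * cnj (fourier k t))"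
    proof (rule integrable_norm_mult_bounded)
      show "integrable lborel (\<lambda>t. complex_of_real (exp (- (?e n * t)\<^sup>2 / 2)))"
        using integrable_gauss[OF pos] by (rule integrable_of_real)
      show "norm (cnj (fourier k t)) \<le> (LINT s|lborel. norm (k s)) / sqrt (2 * pi)" for t
        using fourier_bounded[of k t] k by simp
    qed simp
    then have "integrable lborel (\<lambda>t. cnj (fourier k t) * complex_of_real (exp (- (?e n * t)\<^sup>2 / 2)))"
      by (simp only: mult.commute)
    from fourier_duality[OF h this] show ?thesis
      by (simp only: fourier_gaussian_cutoff[OF test_function_integrable[OF k] pos] mult.assoc)
  qed
  moreover have "(\<lambda>n. LINT s|lborel. h s * ?A n s) \<longlonglongrightarrow> (LINT s|lborel. h s * cnj (k s))"
  proof (rule integral_dominated_convergence[where w = "\<lambda>s. norm (h s) * M"])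
    have "AE s in lborel. isCont k s" using k by (simp add: test_function_def)
    then show "AE s in lborel. (\<lambda>n. h s * ?A n s) \<longlonglongrightarrow> h s * cnj (k s)"
    proof eventually_elim
      case (elim s)
      show ?case
      proof (intro tendsto_mult tendsto_const gaussian_average_tendsto[where M = M and k = "\<lambda>x. cnj (k x)"])
        show "isCont (\<lambda>x. cnj (k x)) s" using elim by (intro continuous_intros)
        show "(\<lambda>n. inverse (real (Suc n))) \<longlonglongrightarrow> 0" by (rule LIMSEQ_inverse_real_of_nat)
      qed (use M in auto)
    qed
    show "AE s in lborel. norm (h s * ?A n s) \<le> norm (h s) * M" for n
    proof (intro AE_I2)
      fix s
      have "norm (?A n s) \<le> (LINT u|lborel. M * std_normal_density u)"
      proof (rule Bochner_Integration.integral_norm_bound_integral)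
        show w: "integrable lborel (\<lambda>u. M * std_normal_density u)"
          by (intro integrable_mult_right integrable_normal_density) simp
        show bd: "norm (cnj (k (s + ?e n * u)) * complex_of_real (std_normal_density u)) \<le> M * std_normal_density u" for u
          by (simp add: norm_mult mult_right_mono M)
        show "integrable lborel (\<lambda>u. cnj (k (s + ?e n * u)) * complex_of_real (std_normal_density u))"
        proof (rule Bochner_Integration.integrable_bound[OF w])
          show "AE u in lborel. norm (cnj (k (s + ?e n * u)) * complex_of_real (std_normal_density u))
            \<le> norm (M * std_normal_density u)"
            using bd by (intro AE_I2) (auto intro: order_trans[OF _ abs_ge_self])
        qed measurable
      qed
      then show "norm (h s * ?A n s) \<le> norm (h s) * M"
        by (simp add: norm_mult mult_left_mono)
    qed
  qed (use h in auto)
  ultimately show ?thesis by simp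
qed

text \<open>
For \<open>k = h\<close> the regularised integrals increase to the integral of \<open>\<bar>fourier h\<bar>\<^sup>2\<close>, so monotone
convergence gives integrability and the value at once.
\<close>

lemma Plancherel:
  assumes h: "test_function h"
  shows "integrable lborel (\<lambda>t. (norm (fourier h t))\<^sup>2)"
    and "(LINT t|lborel. (norm (fourier h t))\<^sup>2) = (LINT s|lborel. (norm (h s))\<^sup>2)"
proof -
  let ?g = "\<lambda>n t. exp (- (inverse (real (Suc n)) * t)\<^sup>2 / 2)"
  let ?f = "\<lambda>n t. (norm (fourier h t))\<^sup>2 * ?g n t"
  have [measurable]: "fourier h \<in> borel_measurable borel" using h by simp
  have "(\<lambda>n. Re (LINT t|lborel. complex_of_real (?f n t))) \<longlonglongrightarrow>
      Re (LINT s|lborel. complex_of_real ((norm (h s))\<^sup>2))"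
    using tendsto_Re[OF regularised_Parseval[OF test_function_integrable[OF h] h]]
    by (simp only: complex_norm_square of_real_mult)
  then have lim: "(\<lambda>n. integral\<^sup>L lborel (?f n)) \<longlonglongrightarrow> (LINT s|lborel. (norm (h s))\<^sup>2)"
    unfolding integral_complex_of_real by simp
  have int: "integrable lborel (?f n)" for n
  proof (rule Bochner_Integration.integrable_bound)
    let ?C = "((LINT s|lborel. norm (h s)) / sqrt (2 * pi))\<^sup>2"
    show "integrable lborel (\<lambda>t. ?C * ?g n t)"
      by (intro integrable_mult_right integrable_gauss) simp
    show "AE t in lborel. norm (?f n t) \<le> norm (?C * ?g n t)"
      using h by (intro AE_I2) (simp add: abs_mult fourier_bounded power_mono mult_right_mono del: power_divide)
  qed simp
  have mono: "AE t in lborel. mono (\<lambda>n. ?f n t)"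
  proof (intro AE_I2 monoI mult_left_mono)
    fix t and m n :: nat assume "m \<le> n"
    then have "inverse (real (Suc n)) \<le> inverse (real (Suc m))" by simp
    then have "inverse (real (Suc n)) ^ 2 \<le> inverse (real (Suc m)) ^ 2"
      by (intro power_mono) auto
    then show "?g m t \<le> ?g n t"
      by (simp add: power_mult_distrib mult_right_mono del: inverse_Suc)
  qed simp
  have point: "AE t in lborel. (\<lambda>n. ?f n t) \<longlonglongrightarrow> (norm (fourier h t))\<^sup>2"
  proof (rule AE_I2)
    fix t
    have "(\<lambda>n. ?f n t) \<longlonglongrightarrow> (norm (fourier h t))\<^sup>2 * exp (- (0 * t)\<^sup>2 / 2)"
      by (intro tendsto_intros LIMSEQ_inverse_real_of_nat) simp_all
    then show "(\<lambda>n. ?f n t) \<longlonglongrightarrow> (norm (fourier h t))\<^sup>2" by simp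
  qed
  show "integrable lborel (\<lambda>t. (norm (fourier h t))\<^sup>2)"
    by (rule integrable_monotone_convergence[OF int mono point lim]) simp
  show "(LINT t|lborel. (norm (fourier h t))\<^sup>2) = (LINT s|lborel. (norm (h s))\<^sup>2)"
    by (rule integral_monotone_convergence[OF int mono point lim]) simp
qed

lemma integrable_mult_L2:
  fixes f g :: "'a \<Rightarrow> complex"
  assumes "f \<in> borel_measurable M" "g \<in> borel_measurable M"
    "integrable M (\<lambda>x. (norm (f x))\<^sup>2)" "integrable M (\<lambda>x. (norm (g x))\<^sup>2)"
  shows "integrable M (\<lambda>x. f x * g x)"
proof (rule Bochner_Integration.integrable_bound)
  show "integrable M (\<lambda>x. (norm (f x))\<^sup>2 + (norm (g x))\<^sup>2)" using assms by simp
  show "(\<lambda>x. f x * g x) \<in> borel_measurable M" using assms by measurable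
  show "AE x in M. norm (f x * g x) \<le> norm ((norm (f x))\<^sup>2 + (norm (g x))\<^sup>2)"
  proof (rule AE_I2)
    fix x
    have "2 * norm (f x) * norm (g x) \<le> (norm (f x))\<^sup>2 + (norm (g x))\<^sup>2"
      by (rule sum_squares_bound)
    moreover have "0 \<le> norm (f x) * norm (g x)" by simp
    ultimately show "norm (f x * g x) \<le> norm ((norm (f x))\<^sup>2 + (norm (g x))\<^sup>2)"
      unfolding norm_mult real_norm_def by linarith
  qed
qed

text \<open>
Now that the product is known to be integrable, the Gaussian factor can be removed by dominated
convergence.
\<close>

lemma Parseval:
  assumes h: "test_function h" and k: "test_function k"
  shows "(LINT t|lborel. fourier h t * cnj (fourier k t)) = (LINT s|lborel. h s * cnj (k s))"
proof -
  let ?g = "\<lambda>n t. complex_of_real (exp (- (inverse (real (Suc n)) * t)\<^sup>2 / 2))"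
  have [measurable]: "fourier h \<in> borel_measurable borel" "fourier k \<in> borel_measurable borel" using h k by simp_all
  have int: "integrable lborel (\<lambda>t. fourier h t * cnj (fourier k t))"
    by (rule integrable_mult_L2) (simp_all add: Plancherel h k)
  have "(\<lambda>n. LINT t|lborel. fourier h t * cnj (fourier k t) * ?g n t) \<longlonglongrightarrow> (LINT t|lborel. fourier h t * cnj (fourier k t))"
  proof (rule integral_dominated_convergence[where w = "\<lambda>t. norm (fourier h t * cnj (fourier k t))"])
    show "AE t in lborel. (\<lambda>n. fourier h t * cnj (fourier k t) * ?g n t) \<longlonglongrightarrow> fourier h t * cnj (fourier k t)"
    proof (rule AE_I2)
      fix t
      have "(\<lambda>n. fourier h t * cnj (fourier k t) * ?g n t) \<longlonglongrightarrow>
          fourier h t * cnj (fourier k t) * complex_of_real (exp (- (0 * t)\<^sup>2 / 2))"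
        by (intro tendsto_intros LIMSEQ_inverse_real_of_nat) simp_all
      then show "(\<lambda>n. fourier h t * cnj (fourier k t) * ?g n t) \<longlonglongrightarrow> fourier h t * cnj (fourier k t)" by simp
    qed
    show "AE t in lborel. norm (fourier h t * cnj (fourier k t) * ?g n t) \<le> norm (fourier h t * cnj (fourier k t))" for n
      by (intro AE_I2) (simp add: norm_mult mult_left_le)
  qed (use int in auto)
  from LIMSEQ_unique[OF this regularised_Parseval[OF test_function_integrable[OF h] k]]
  show ?thesis .
qed

section \<open>Inversion of the Fourier transform in the mean\<close>

lemma test_function_scaleR_indicator:
  assumes A: "A \<in> sets borel" "emeasure lborel A < \<infinity>" "AE x in lborel. x \<notin> frontier A"
    and f: "f \<in> borel_measurable borel" "\<And>x. norm (f x) \<le> C" "AE x in lborel. isCont f x"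
  shows "test_function (\<lambda>x. indicator A x *\<^sub>R f x)"
  unfolding test_function_def
proof (intro conjI)
  have "integrable lborel (\<lambda>x. complex_of_real (indicator A x) * f x)"
    by (rule integrable_norm_mult_bounded[where C = C]) (use A f in \<open>auto intro!: integrable_of_real integrable_real_indicator\<close>)
  then show "integrable lborel (\<lambda>x. indicator A x *\<^sub>R f x)" by (simp add: scaleR_conv_of_real)
  have "0 \<le> C" using f(2)[of 0] norm_ge_zero order_trans by blast
  then have "norm (indicator A x *\<^sub>R f x) \<le> C" for x
    using f(2) by (auto simp: indicator_def)
  then show "bounded (range (\<lambda>x. indicator A x *\<^sub>R f x))" by (auto simp: bounded_iff)
  show "AE x in lborel. isCont (\<lambda>x. indicator A x *\<^sub>R f x) x"
    using A(3) f(3)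
  proof eventually_elim
    case (elim x)
    then show ?case
      by (intro isCont_scaleR) (simp_all add: isCont_indicator)
  qed
qed

lemma AE_not_in_frontier_interval:
  "AE x in lborel. x \<notin> frontier {a..<b::real}" "AE x in lborel. x \<notin> frontier {a..b::real}"
proof -
  have "AE x in lborel. x \<noteq> a" "AE x in lborel. x \<noteq> b" by (rule AE_lborel_singleton)+
  then have ae: "AE x in lborel. x \<noteq> a \<and> x \<noteq> b" by simp
  have *: "x \<in> interior A" if "x \<in> {a<..<b}" "{a<..<b} \<subseteq> A" for x A
    using that by (rule_tac interiorI[of "{a<..<b}"]) auto
  have "x \<notin> frontier {a..<b}" "x \<notin> frontier {a..b}" if "x \<noteq> a \<and> x \<noteq> b" for x
  proof -
    have "x \<notin> frontier A" if A: "{a<..<b} \<subseteq> A" "A \<subseteq> {a..b}" for A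
    proof
      assume "x \<in> frontier A"
      moreover have "closure A \<subseteq> {a..b}" using A(2) by (intro closure_minimal) auto
      ultimately have "x \<in> {a<..<b}" using \<open>x \<noteq> a \<and> x \<noteq> b\<close> by (auto simp: frontier_def)
      with * A \<open>x \<in> frontier A\<close> show False by (auto simp: frontier_def)
    qed
    note sub = this
    show "x \<notin> frontier {a..<b}" by (rule sub) auto
    show "x \<notin> frontier {a..b}" by (rule sub) auto
  qed
  with ae show "AE x in lborel. x \<notin> frontier {a..<b::real}" "AE x in lborel. x \<notin> frontier {a..b::real}"
    by auto
qed

lemma borel_measurable_lebesgue:
  "f \<in> borel_measurable borel \<Longrightarrow> f \<in> borel_measurable lebesgue"
  by (rule measurable_completion) simp

text \<open>
As a nonnegative integral the squared distance is meaningful for all pairs of functions, infinite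
values included; squares obey the triangle inequality up to the factor two, which is harmless for
closures.
\<close>

definition L2_dist_sq :: "(real \<Rightarrow> complex) \<Rightarrow> (real \<Rightarrow> complex) \<Rightarrow> ennreal" where
  "L2_dist_sq f g = (\<integral>\<^sup>+ x. ennreal ((cmod (f x - g x))\<^sup>2) \<partial>lebesgue)"

lemma fourier_reflect: "fourier (\<lambda>s. h (- s)) t = fourier h (- t)"
  unfolding fourier_def by (subst lborel_integral_real_affine[of "-1" _ 0]) simp_all

lemma test_function_cutoff_fourier:
  assumes "test_function h"
  shows "test_function (\<lambda>t. indicator {-R..R} t *\<^sub>R fourier h (c * t))"
proof (rule test_function_scaleR_indicator)
  show "emeasure lborel {-R..R} < \<infinity>" by (simp add: emeasure_lborel_Icc_eq)
  show "norm (fourier h (c * t)) \<le> (LINT s|lborel. norm (h s)) / sqrt (2 * pi)" for t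
    using fourier_bounded assms by simp
  have [measurable]: "fourier h \<in> borel_measurable borel" using assms by simp
  show "(\<lambda>t. fourier h (c * t)) \<in> borel_measurable borel" by measurable
  have "isCont (\<lambda>t. fourier h (c * t)) x" for x
    by (rule isCont_o2[of _ "\<lambda>t. c * t" "fourier h"]) (use assms in \<open>auto intro!: isCont_fourier continuous_intros\<close>)
  then show "AE t in lborel. isCont (\<lambda>t. fourier h (c * t)) t" by simp
qed (auto simp: AE_not_in_frontier_interval)

text \<open>
Let \<open>u t = fourier h (- t)\<close> and let \<open>v\<close> be its cut-off to \<open>[-R, R]\<close>. In the expansion of
\<open>\<parallel>fourier v - h\<parallel>\<^sup>2\<close> the first term is \<open>\<parallel>v\<parallel>\<^sup>2\<close> by Plancherel's theorem and the inner product
\<open>\<langle>fourier v, h\<rangle>\<close> equals \<open>\<langle>v, u\<rangle> = \<parallel>v\<parallel>\<^sup>2\<close> by duality, so the distance is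
\<open>\<parallel>h\<parallel>\<^sup>2 - \<parallel>v\<parallel>\<^sup>2 = \<parallel>u\<parallel>\<^sup>2 - \<parallel>v\<parallel>\<^sup>2\<close>, the mass of \<open>u\<close> outside \<open>[-R, R]\<close>.
\<close>

lemma Fourier_inversion_L2:
  assumes h: "test_function h"
  shows "((\<lambda>R. L2_dist_sq (fourier (\<lambda>t. indicator {-R..R} t *\<^sub>R fourier h (- t))) h) \<longlongrightarrow> 0) at_top"
proof -
  let ?u = "\<lambda>t. fourier h (- t)"
  let ?v = "\<lambda>R t. indicator {-R..R} t *\<^sub>R ?u t"
  let ?I = "\<lambda>R. LINT t|lborel. indicator {-R..R} t *\<^sub>R (norm (?u t))\<^sup>2"
  have FTh [measurable]: "fourier h \<in> borel_measurable borel" and h_meas [measurable]: "h \<in> borel_measurable borel"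
    using h test_function_measurable[OF h] by simp_all
  have v: "test_function (?v R)" for R using test_function_cutoff_fourier[OF h, of R "-1"] by simp
  have u_int: "integrable lborel (\<lambda>t. (norm (?u t))\<^sup>2)"
    using lborel_integrable_real_affine[OF Plancherel(1)[OF h], of "-1" 0] by simp
  have u_norm: "(LINT t|lborel. (norm (?u t))\<^sup>2) = (LINT s|lborel. (norm (h s))\<^sup>2)"
    using lborel_integral_real_affine[of "-1" "\<lambda>t. (norm (fourier h t))\<^sup>2" 0] Plancherel(2)[OF h] by simp
  have dist: "L2_dist_sq (fourier (?v R)) h = ennreal ((LINT s|lborel. (norm (h s))\<^sup>2) - ?I R)" for R
  proof -
    have [measurable]: "fourier (?v R) \<in> borel_measurable borel" using v by simp
    have vsq: "(norm (?v R t))\<^sup>2 = indicator {-R..R} t *\<^sub>R (norm (?u t))\<^sup>2" for t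
      by (simp add: indicator_def)
    have int1: "integrable lborel (\<lambda>t. (norm (fourier (?v R) t))\<^sup>2)" by (rule Plancherel(1)[OF v])
    have int2: "integrable lborel (\<lambda>t. (norm (h t))\<^sup>2)" by (rule test_function_square_integrable[OF h])
    have int3: "integrable lborel (\<lambda>t. fourier (?v R) t * cnj (h t))"
      by (rule integrable_mult_L2) (simp_all add: int1 int2)
    have "(LINT t|lborel. fourier (?v R) t * cnj (h t)) = (LINT t|lborel. ?v R t * fourier (\<lambda>t. cnj (h t)) t)"
      by (rule fourier_duality) (use v h in auto)
    also have "\<dots> = (LINT t|lborel. complex_of_real (indicator {-R..R} t *\<^sub>R (norm (?u t))\<^sup>2))"
    proof (rule Bochner_Integration.integral_cong[OF refl])
      fix t
      have "fourier (\<lambda>t. cnj (h t)) t = cnj (?u t)" by (simp add: cnj_fourier)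
      then show "?v R t * fourier (\<lambda>t. cnj (h t)) t = complex_of_real (indicator {-R..R} t *\<^sub>R (norm (?u t))\<^sup>2)"
        by (simp add: scaleR_conv_of_real mult.assoc flip: complex_norm_square)
    qed
    also have "\<dots> = complex_of_real (?I R)" by (rule integral_complex_of_real)
    finally have cross: "Re (LINT t|lborel. fourier (?v R) t * cnj (h t)) = ?I R" by simp
    have eq: "(cmod (fourier (?v R) t - h t))\<^sup>2 =
        (norm (fourier (?v R) t))\<^sup>2 - 2 * Re (fourier (?v R) t * cnj (h t)) + (norm (h t))\<^sup>2" for t
      unfolding cmod_power2 by (simp add: power2_eq_square algebra_simps)
    have int: "integrable lborel (\<lambda>x. (cmod (fourier (?v R) x - h x))\<^sup>2)"
      unfolding eq by (intro Bochner_Integration.integrable_add Bochner_Integration.integrable_diff integrable_mult_right integrable_Re int1 int2 int3)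
    have "L2_dist_sq (fourier (?v R)) h = (\<integral>\<^sup>+ x. ennreal ((cmod (fourier (?v R) x - h x))\<^sup>2) \<partial>lborel)"
      unfolding L2_dist_sq_def by (rule nn_integral_completion)
    also have "\<dots> = ennreal (LINT x|lborel. (cmod (fourier (?v R) x - h x))\<^sup>2)"
      by (rule nn_integral_eq_integral[OF int]) simp
    also have "(LINT x|lborel. (cmod (fourier (?v R) x - h x))\<^sup>2) =
        (LINT t|lborel. (norm (fourier (?v R) t))\<^sup>2) - 2 * Re (LINT t|lborel. fourier (?v R) t * cnj (h t))
        + (LINT s|lborel. (norm (h s))\<^sup>2)"
      unfolding eq using int1 int2 int3 by (simp del: times_complex.sel)
    also have "\<dots> = (LINT s|lborel. (norm (h s))\<^sup>2) - ?I R"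
      unfolding Plancherel(2)[OF v] cross vsq by simp
    finally show ?thesis .
  qed
  have "(?I \<longlongrightarrow> (LINT t|lborel. (norm (?u t))\<^sup>2)) at_top"
  proof (rule integral_dominated_convergence_at_top)
    show "AE t in lborel. ((\<lambda>R. indicator {-R..R} t *\<^sub>R (norm (?u t))\<^sup>2) \<longlongrightarrow> (norm (?u t))\<^sup>2) at_top"
    proof (intro AE_I2 tendsto_eventually)
      fix t :: real
      show "\<forall>\<^sub>F R in at_top. indicator {-R..R} t *\<^sub>R (norm (?u t))\<^sup>2 = (norm (?u t))\<^sup>2"
        using eventually_ge_at_top[of "\<bar>t\<bar>"] by eventually_elim (auto simp: indicator_def)
    qed
    show "\<forall>\<^sub>F R in at_top. AE t in lborel. norm (indicator {-R..R} t *\<^sub>R (norm (?u t))\<^sup>2) \<le> (norm (?u t))\<^sup>2"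
      by (intro always_eventually allI AE_I2) (simp add: indicator_def)
  qed (use u_int in auto)
  then have "((\<lambda>R. (LINT s|lborel. (norm (h s))\<^sup>2) - ?I R) \<longlongrightarrow> (LINT s|lborel. (norm (h s))\<^sup>2) - (LINT s|lborel. (norm (h s))\<^sup>2)) at_top"
    unfolding u_norm by (intro tendsto_intros)
  then have "((\<lambda>R. ennreal ((LINT s|lborel. (norm (h s))\<^sup>2) - ?I R)) \<longlongrightarrow> ennreal 0) at_top"
    by (intro tendsto_ennrealI) simp
  then show ?thesis unfolding dist by simp
qed

section \<open>Approximation in the mean\<close>

text \<open>
The approximants are measurable so that the triangle inequality applies to them.
\<close>

definition L2_closure :: "(real \<Rightarrow> complex) set \<Rightarrow> (real \<Rightarrow> complex) set" where
  "L2_closure S = {f \<in> borel_measurable lebesgue. \<forall>\<epsilon>>0. \<exists>g\<in>S. g \<in> borel_measurable lebesgue \<and> L2_dist_sq f g < \<epsilon>}"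

lemma L2_dist_sq_triangle:
  assumes [measurable]: "f \<in> borel_measurable lebesgue" "g \<in> borel_measurable lebesgue" "h \<in> borel_measurable lebesgue"
  shows "L2_dist_sq f h \<le> 2 * L2_dist_sq f g + 2 * L2_dist_sq g h"
proof -
  have "L2_dist_sq f h \<le> (\<integral>\<^sup>+ x. 2 * ennreal ((cmod (f x - g x))\<^sup>2) + 2 * ennreal ((cmod (g x - h x))\<^sup>2) \<partial>lebesgue)"
    unfolding L2_dist_sq_def
  proof (rule nn_integral_mono)
    fix x
    have "cmod (f x - h x) \<le> cmod (f x - g x) + cmod (g x - h x)"
      using norm_triangle_ineq[of "f x - g x" "g x - h x"] by simp
    then have "(cmod (f x - h x))\<^sup>2 \<le> (cmod (f x - g x) + cmod (g x - h x))\<^sup>2" by (rule power_mono) simp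
    also have "\<dots> \<le> 2 * (cmod (f x - g x))\<^sup>2 + 2 * (cmod (g x - h x))\<^sup>2"
      using sum_squares_bound[of "cmod (f x - g x)" "cmod (g x - h x)"] by (simp add: power2_sum)
    finally have "ennreal ((cmod (f x - h x))\<^sup>2) \<le> ennreal (2 * (cmod (f x - g x))\<^sup>2 + 2 * (cmod (g x - h x))\<^sup>2)"
      by (rule ennreal_leI)
    then show "ennreal ((cmod (f x - h x))\<^sup>2) \<le> 2 * ennreal ((cmod (f x - g x))\<^sup>2) + 2 * ennreal ((cmod (g x - h x))\<^sup>2)"
      by (simp add: ennreal_mult)
  qed
  also have "\<dots> = 2 * L2_dist_sq f g + 2 * L2_dist_sq g h"
    unfolding L2_dist_sq_def by (subst nn_integral_add) (simp_all add: nn_integral_cmult)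
  finally show ?thesis .
qed

lemma L2_closure_subset: "S \<subseteq> borel_measurable lebesgue \<Longrightarrow> S \<subseteq> L2_closure S"
  by (force simp: L2_closure_def L2_dist_sq_def)

lemma ennreal_less_add_half:
  fixes a b :: ennreal
  assumes "0 < \<epsilon>" "a < \<epsilon> / 4" "b < \<epsilon> / 4"
  shows "2 * a + 2 * b < \<epsilon>"
proof (cases \<epsilon>)
  case top
  then show ?thesis using assms by (simp add: ennreal_add_eq_top ennreal_mult_eq_top_iff less_top[symmetric] ennreal_top_divide)
next
  case (real e)
  then have "\<epsilon> / 4 = ennreal (e / 4)" by (simp add: divide_ennreal[symmetric])
  with assms have ab: "a < ennreal (e / 4)" "b < ennreal (e / 4)" by simp_all
  then obtain x y where xy: "a = ennreal x" "b = ennreal y" "0 \<le> x" "0 \<le> y"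
    by (metis ennreal_cases less_top top.not_eq_extremum order_less_trans)
  have "2 * a + 2 * b = ennreal (2 * x + 2 * y)" using xy by (simp add: ennreal_mult)
  moreover have "x < e / 4" "y < e / 4" using ab xy by (simp_all add: ennreal_less_iff)
  moreover have "ennreal (2 * x + 2 * y) < ennreal e"
    using xy calculation(2,3) by (intro ennreal_lessI) linarith+
  ultimately show ?thesis using real by simp
qed

lemma L2_closure_trans:
  assumes "f \<in> L2_closure S" "S \<subseteq> L2_closure T"
  shows "f \<in> L2_closure T"
proof -
  have "\<exists>h\<in>T. h \<in> borel_measurable lebesgue \<and> L2_dist_sq f h < \<epsilon>" if "0 < \<epsilon>" for \<epsilon> :: ennreal
  proof -
    have e: "0 < \<epsilon> / 4" using that by (simp add: ennreal_zero_less_divide)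
    obtain g where g: "g \<in> S" "L2_dist_sq f g < \<epsilon> / 4" "g \<in> borel_measurable lebesgue" using assms(1) e by (auto simp: L2_closure_def)
    obtain h where h: "h \<in> T" "h \<in> borel_measurable lebesgue" "L2_dist_sq g h < \<epsilon> / 4"
      using g(1) assms(2) e by (auto simp: L2_closure_def)
    have "L2_dist_sq f h \<le> 2 * L2_dist_sq f g + 2 * L2_dist_sq g h"
      by (rule L2_dist_sq_triangle) (use assms(1) g h in \<open>auto simp: L2_closure_def\<close>)
    also have "\<dots> < \<epsilon>" using ennreal_less_add_half that g h by blast
    finally show ?thesis using h by blast
  qed
  then show ?thesis using assms(1) by (simp add: L2_closure_def)
qed

lemma L2_closure_tendsto:
  assumes "f \<in> borel_measurable lebesgue" "\<And>n. g n \<in> S" "\<And>n. g n \<in> borel_measurable lebesgue"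
    and lim: "((\<lambda>n. L2_dist_sq f (g n)) \<longlongrightarrow> 0) F" and F: "F \<noteq> bot"
  shows "f \<in> L2_closure S"
proof -
  have "\<exists>h\<in>S. h \<in> borel_measurable lebesgue \<and> L2_dist_sq f h < \<epsilon>" if "0 < \<epsilon>" for \<epsilon> :: ennreal
  proof -
    from order_tendstoD(2)[OF lim that] obtain n where "L2_dist_sq f (g n) < \<epsilon>"
      using F by (auto dest: eventually_happens)
    with assms show ?thesis by blast
  qed
  with assms show ?thesis by (simp add: L2_closure_def)
qed

lemma L2_closure_dominated:
  fixes g :: "nat \<Rightarrow> real \<Rightarrow> complex" and w :: "real \<Rightarrow> real"
  assumes [measurable]: "f \<in> borel_measurable lebesgue" "\<And>n. g n \<in> borel_measurable lebesgue"
    and S: "\<And>n. g n \<in> S"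
    and w: "integrable lebesgue (\<lambda>x. (w x)\<^sup>2)"
    and dom: "\<And>x. norm (f x) \<le> w x" "\<And>n x. norm (g n x) \<le> w x"
    and lim: "AE x in lebesgue. (\<lambda>n. g n x) \<longlonglongrightarrow> f x"
  shows "f \<in> L2_closure S"
proof (rule L2_closure_tendsto[where g = g and F = sequentially])
  have "(\<lambda>n. \<integral>\<^sup>+x. ennreal ((cmod (f x - g n x))\<^sup>2) \<partial>lebesgue) \<longlonglongrightarrow> (\<integral>\<^sup>+(x::real). 0 \<partial>lebesgue)"
  proof (rule nn_integral_dominated_convergence[where w = "\<lambda>x. ennreal (4 * (w x)\<^sup>2)"])
    show "AE x in lebesgue. ennreal ((cmod (f x - g n x))\<^sup>2) \<le> ennreal (4 * (w x)\<^sup>2)" for n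
    proof (intro AE_I2 ennreal_leI)
      fix x
      have "cmod (f x - g n x) \<le> 2 * w x"
        using dom(1)[of x] dom(2)[where n = n and x = x] norm_triangle_ineq4[of "f x" "g n x"] by linarith
      then have "(cmod (f x - g n x))\<^sup>2 \<le> (2 * w x)\<^sup>2" by (rule power_mono) simp
      then show "(cmod (f x - g n x))\<^sup>2 \<le> 4 * (w x)\<^sup>2" by (simp add: power_mult_distrib)
    qed
    have "(\<integral>\<^sup>+x. ennreal (4 * (w x)\<^sup>2) \<partial>lebesgue) = ennreal (LINT x|lebesgue. 4 * (w x)\<^sup>2)"
      using w by (intro nn_integral_eq_integral) auto
    then show "(\<integral>\<^sup>+x. ennreal (4 * (w x)\<^sup>2) \<partial>lebesgue) < \<infinity>" by simp
    show "(\<lambda>x. ennreal (4 * (w x)\<^sup>2)) \<in> borel_measurable lebesgue" using w by measurable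
    show "AE x in lebesgue. (\<lambda>n. ennreal ((cmod (f x - g n x))\<^sup>2)) \<longlonglongrightarrow> 0"
      using lim
    proof eventually_elim
      case (elim x)
      have "(\<lambda>n. (cmod (f x - g n x))\<^sup>2) \<longlonglongrightarrow> (cmod (f x - f x))\<^sup>2"
        by (intro tendsto_intros elim)
      then have "(\<lambda>n. ennreal ((cmod (f x - g n x))\<^sup>2)) \<longlonglongrightarrow> ennreal ((cmod (f x - f x))\<^sup>2)"
        by (rule tendsto_ennrealI)
      then show ?case by simp
    qed
  qed measurable
  then show "(\<lambda>n. L2_dist_sq f (g n)) \<longlonglongrightarrow> 0" by (simp add: L2_dist_sq_def)
qed (use S in auto)

section \<open>Density of Fourier integrals\<close>

text \<open>
A Lebesgue measurable function is almost everywhere a limit of continuous functions; composing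
these with the nearest-point projection onto the disc of radius \<open>M\<close> keeps them bounded.
\<close>

lemma bounded_measurable_continuous_approximation:
  fixes f :: "real \<Rightarrow> complex"
  assumes f: "f \<in> borel_measurable lebesgue" and M: "\<And>x. norm (f x) \<le> M"
  obtains c :: "nat \<Rightarrow> real \<Rightarrow> complex" where "\<And>n. continuous_on UNIV (c n)" "\<And>n x. norm (c n x) \<le> M"
    "AE x in lebesgue. (\<lambda>n. c n x) \<longlonglongrightarrow> f x"
proof -
  have "0 \<le> M" using M[of 0] norm_ge_zero order_trans by blast
  have "f measurable_on UNIV"
    by (rule lebesgue_measurable_imp_measurable_on[OF f]) simp
  then obtain N g where N: "negligible N" and g: "\<And>n. continuous_on UNIV (g n :: real \<Rightarrow> complex)"
    and lim: "\<And>x. x \<notin> N \<Longrightarrow> (\<lambda>n. g n x) \<longlonglongrightarrow> f x"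
    unfolding measurable_on_def by auto
  \<comment> \<open>The projection fixes the values of \<open>f\<close>, so it does not disturb the limit.\<close>
  let ?P = "closest_point (cball 0 M :: complex set)"
  have P: "continuous_on UNIV ?P"
    by (rule continuous_on_closest_point) (use \<open>0 \<le> M\<close> in auto)
  show ?thesis
  proof
    show "continuous_on UNIV (\<lambda>x. ?P (g n x))" for n
      using continuous_on_compose2[OF P g] by auto
    have "?P z \<in> cball 0 M" for z
      by (rule closest_point_in_set) (use \<open>0 \<le> M\<close> in auto)
    then show "norm (?P (g n x)) \<le> M" for n x by simp
    have "AE x in lebesgue. x \<notin> N"
      using N by (auto simp: negligible_iff_null_sets intro: AE_not_in)
    then show "AE x in lebesgue. (\<lambda>n. ?P (g n x)) \<longlonglongrightarrow> f x"
    proof eventually_elim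
      case (elim x)
      have "(\<lambda>n. ?P (g n x)) \<longlonglongrightarrow> ?P (f x)"
        using continuous_on_tendsto_compose[OF P lim[OF elim]] by simp
      moreover have "?P (f x) = f x" using M by (intro closest_point_self) simp
      ultimately show ?case by simp
    qed
  qed
qed

lemma test_function_cutoff_continuous:
  assumes "continuous_on UNIV c" "\<And>x. norm (c x) \<le> M"
  shows "test_function (\<lambda>x. indicator {-R..R} x *\<^sub>R c x)"
  by (rule test_function_scaleR_indicator)
    (use assms in \<open>auto simp: emeasure_lborel_Icc_eq AE_not_in_frontier_interval continuous_on_eq_continuous_at
      intro!: borel_measurable_continuous_onI\<close>)

lemma square_integrable_indicator:
  fixes M :: real
  assumes "A \<in> sets lebesgue" "emeasure lebesgue A < \<infinity>"
  shows "integrable lebesgue (\<lambda>x. (M * indicator A x)\<^sup>2)"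
proof -
  have "integrable lebesgue (\<lambda>x. M\<^sup>2 * indicator A x)"
    using assms by (intro integrable_mult_right integrable_real_indicator)
  moreover have "(M * indicator A x)\<^sup>2 = M\<^sup>2 * indicator A x" for x
    by (simp add: indicator_def)
  ultimately show ?thesis by simp
qed

text \<open>
Truncate \<open>f\<close> in domain and range, approximate the truncation by a continuous function cut off to a
bounded interval, which is a test function, and apply the inversion formula to the latter.
\<close>

lemma Fourier_images_dense:
  assumes f: "f \<in> L2_fun"
  shows "f \<in> L2_closure {\<lambda>t. fourier k (- t) | k. test_function k}"
proof (rule L2_closure_trans)
  let ?S = "{f :: real \<Rightarrow> complex. f \<in> borel_measurable lebesgue \<and> (\<exists>n. \<forall>x. norm (f x) \<le> n * indicator {-n..n} x)}"
  let ?I = "{f. test_function f}"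
  have f_meas [measurable]: "f \<in> borel_measurable lebesgue" and f_int: "integrable lebesgue (\<lambda>x. (norm (f x))\<^sup>2)"
    using f by (auto simp: L2_fun_def)
  show "f \<in> L2_closure ?S"
  proof (rule L2_closure_dominated[where w = "\<lambda>x. norm (f x)"])
    let ?A = "\<lambda>n. {x \<in> space lebesgue. \<bar>x\<bar> \<le> real n \<and> norm (f x) \<le> real n}"
    have [measurable]: "(\<lambda>x::real. x) \<in> borel_measurable lebesgue"
      by (rule borel_measurable_lebesgue) simp
    show g_meas: "(\<lambda>x. indicator (?A n) x *\<^sub>R f x) \<in> borel_measurable lebesgue" for n
      by measurable
    show "(\<lambda>x. indicator (?A n) x *\<^sub>R f x) \<in> ?S" for n
      using g_meas[of n] by (auto simp: indicator_def intro!: exI[of _ "real n"])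
    show "AE x in lebesgue. (\<lambda>n. indicator (?A n) x *\<^sub>R f x) \<longlonglongrightarrow> f x"
    proof (intro AE_I2 tendsto_eventually)
      fix x :: real
      obtain N :: nat where "max \<bar>x\<bar> (norm (f x)) \<le> real N" using real_arch_simple by blast
      then show "\<forall>\<^sub>F n in sequentially. indicator (?A n) x *\<^sub>R f x = f x"
        by (intro eventually_sequentiallyI[of N]) (auto simp: indicator_def)
    qed
  qed (use f_int in \<open>auto simp: indicator_def\<close>)
  show "?S \<subseteq> L2_closure {\<lambda>t. fourier k (- t) | k. test_function k}"
  proof
    fix g assume "g \<in> ?S"
    then obtain n where g: "g \<in> borel_measurable lebesgue" and n: "\<And>x. norm (g x) \<le> n * indicator {-n..n} x"
      by auto
    have n1: "norm (g x) \<le> \<bar>n\<bar>" for x using n[of x] by (cases "x \<in> {-n..n}") auto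
    obtain c where c: "\<And>m. continuous_on UNIV (c m)" "\<And>m x. norm (c m x) \<le> \<bar>n\<bar>"
      "AE x in lebesgue. (\<lambda>m. c m x) \<longlonglongrightarrow> g x"
      using bounded_measurable_continuous_approximation[OF g n1] by blast
    have cn: "test_function (\<lambda>x. indicator {-n..n} x *\<^sub>R c m x)" for m
      by (rule test_function_cutoff_continuous[OF c(1,2)])
    have "g \<in> L2_closure ?I"
    proof (rule L2_closure_dominated[where w = "\<lambda>x. \<bar>n\<bar> * indicator {-n..n} x"])
      show "(\<lambda>x. indicator {-n..n} x *\<^sub>R c m x) \<in> ?I" for m using cn by simp
      show "(\<lambda>x. indicator {-n..n} x *\<^sub>R c m x) \<in> borel_measurable lebesgue" for m
        using test_function_measurable[OF cn] by (rule borel_measurable_lebesgue)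
      show "integrable lebesgue (\<lambda>x. (\<bar>n\<bar> * indicator {-n..n} x)\<^sup>2)"
        by (rule square_integrable_indicator) (auto simp: emeasure_lborel_Icc_eq)
      show "norm (g x) \<le> \<bar>n\<bar> * indicator {-n..n} x" for x
        using n[of x] by (cases "x \<in> {-n..n}") auto
      show "AE x in lebesgue. (\<lambda>m. indicator {-n..n} x *\<^sub>R c m x) \<longlonglongrightarrow> g x"
        using c(3)
      proof eventually_elim
        case (elim x)
        then show ?case using n[of x] by (auto simp: indicator_def)
      qed
    qed (use g c in \<open>auto simp: indicator_def\<close>)
    then show "g \<in> L2_closure {\<lambda>t. fourier k (- t) | k. test_function k}"
    proof (rule L2_closure_trans, intro subsetI)
      fix h assume "h \<in> ?I"
      then have h: "test_function h" by simp
      let ?k = "\<lambda>R t. indicator {-R..R} t *\<^sub>R fourier h t"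
      have k: "test_function (?k R)" for R using test_function_cutoff_fourier[OF h, of R 1] by simp
      have eq: "fourier (?k R) (- t) = fourier (\<lambda>t. indicator {-R..R} t *\<^sub>R fourier h (- t)) t" for R t
      proof -
        have "(\<lambda>t. indicator {-R..R} t *\<^sub>R fourier h (- t)) = (\<lambda>t. ?k R (- t))"
          by (intro ext arg_cong2[where f = scaleR]) (auto simp: indicator_def)
        then have "fourier (\<lambda>t. indicator {-R..R} t *\<^sub>R fourier h (- t)) t = fourier (\<lambda>t. ?k R (- t)) t"
          by (rule arg_cong)
        also have "\<dots> = fourier (?k R) (- t)" by (rule fourier_reflect)
        finally show ?thesis ..
      qed
      show "h \<in> L2_closure {\<lambda>t. fourier k (- t) | k. test_function k}"
      proof (rule L2_closure_tendsto)
        show "(\<lambda>t. fourier (?k R) (- t)) \<in> {\<lambda>t. fourier k (- t) | k. test_function k}" for R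
          using k by blast
        have "L2_dist_sq h (\<lambda>t. fourier (?k R) (- t)) = L2_dist_sq (fourier (\<lambda>t. indicator {-R..R} t *\<^sub>R fourier h (- t))) h" for R
          unfolding eq L2_dist_sq_def by (simp only: norm_minus_commute)
        then show "((\<lambda>R. L2_dist_sq h (\<lambda>t. fourier (?k R) (- t))) \<longlongrightarrow> 0) at_top"
          using Fourier_inversion_L2[OF h] by simp
        have [measurable]: "fourier (?k R) \<in> borel_measurable borel" for R using k by simp
        show "(\<lambda>t. fourier (?k R) (- t)) \<in> borel_measurable lebesgue" for R
          by (rule borel_measurable_lebesgue) measurable
        show "h \<in> borel_measurable lebesgue"
          using test_function_measurable[OF h] by (rule borel_measurable_lebesgue)
      qed simp
    qed
  qed
qed

section \<open>Trigonometric polynomials\<close>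

text \<open>
Adding one term at a time gives an induction principle that suits proofs by linearity.
\<close>

inductive_set cspan :: "('i \<Rightarrow> 'a \<Rightarrow> complex) \<Rightarrow> ('a \<Rightarrow> complex) set" for e where
  cspan_zero: "(\<lambda>x. 0) \<in> cspan e"
| cspan_step: "f \<in> cspan e \<Longrightarrow> (\<lambda>x. f x + c * e i x) \<in> cspan e"

lemma cspan_add:
  assumes "f \<in> cspan e" "g \<in> cspan e" shows "(\<lambda>x. f x + g x) \<in> cspan e"
  using assms(2)
proof induction
  case (cspan_step g c i)
  from cspan.cspan_step[OF cspan_step(2)] show ?case by (simp add: add.assoc)
qed (use assms(1) in simp)

lemma cspan_scaled_base: "(\<lambda>x. c * e i x) \<in> cspan e"
  using cspan_step[OF cspan_zero, of c e i] by simp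

lemma cspan_imp_finite_sum:
  assumes "f \<in> cspan e"
  shows "\<exists>I c. finite I \<and> f = (\<lambda>x. \<Sum>i\<in>I. c i * e i x)"
  using assms
proof induction
  case cspan_zero
  show ?case by (rule exI[of _ "{}"]) simp
next
  case (cspan_step f d j)
  then obtain I c where I: "finite I" and f: "f = (\<lambda>x. \<Sum>i\<in>I. c i * e i x)" by blast
  let ?c = "\<lambda>i. (if i \<in> I then c i else 0) + (if i = j then d else 0)"
  have "f x + d * e j x = (\<Sum>i\<in>insert j I. ?c i * e i x)" for x
  proof -
    have "(\<Sum>i\<in>insert j I. ?c i * e i x) =
      (\<Sum>i\<in>insert j I. (if i \<in> I then c i * e i x else 0) + (if i = j then d * e i x else 0))"
      by (intro sum.cong) (auto simp: algebra_simps)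
    also have "\<dots> = f x + d * e j x"
      using I by (simp add: sum.distrib f sum.If_cases sum.delta Int_absorb1 subset_insertI)
    finally show ?thesis by simp
  qed
  then show ?case using I by (intro exI[of _ "insert j I"] exI[of _ ?c]) auto
qed

abbreviation trig :: "int \<Rightarrow> real \<Rightarrow> complex" where
  "trig l x \<equiv> cis (- (of_int l * x))"

lemma trig_span_mult:
  assumes "f \<in> cspan trig" "g \<in> cspan trig"
  shows "(\<lambda>x. f x * g x) \<in> cspan trig"
  using assms(2)
proof induction
  case cspan_zero
  show ?case using cspan.cspan_zero by simp
next
  case (cspan_step g d j)
  have "(\<lambda>x. f x * (d * trig j x)) \<in> cspan trig"
    using assms(1)
  proof induction
    case cspan_zero
    show ?case using cspan.cspan_zero by simp
  next
    case (cspan_step f c i)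
    have "c * trig i x * (d * trig j x) = (c * d) * trig (i + j) x" for x
    proof -
      have "trig (i + j) x = trig i x * trig j x" unfolding cis_mult by (simp add: algebra_simps)
      then show ?thesis by simp
    qed
    then have "(\<lambda>x. (f x + c * trig i x) * (d * trig j x)) =
        (\<lambda>x. f x * (d * trig j x) + (c * d) * trig (i + j) x)"
      by (simp only: distrib_right)
    with cspan.cspan_step[OF cspan_step(2), of "c * d" "i + j"] show ?case by (simp only:)
  qed
  with cspan_step(2) have "(\<lambda>x. f x * g x + f x * (d * trig j x)) \<in> cspan trig" by (rule cspan_add)
  then show ?case by (simp only: distrib_left)
qed

text \<open>
A linear form on the plane restricts on the unit circle to a combination of \<open>cos\<close> and \<open>sin\<close>, hence
of \<open>trig 1\<close> and \<open>trig (-1)\<close>; sums and products stay in the span.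
\<close>

lemma trig_span_real_polynomial:
  fixes r :: "complex \<Rightarrow> real"
  assumes "real_polynomial_function r"
  shows "(\<lambda>x. complex_of_real (r (cis x))) \<in> cspan trig"
  using assms
proof induction
  case (linear r)
  have eq: "complex_of_real (r (cis x)) =
    (r 1 - \<i> * r \<i>) / 2 * trig (-1) x + (r 1 + \<i> * r \<i>) / 2 * trig 1 x" for x
  proof -
    interpret bounded_linear r by fact
    have "cis x = cos x *\<^sub>R 1 + sin x *\<^sub>R \<i>" by (simp add: complex_eq_iff)
    then have "r (cis x) = cos x * r 1 + sin x * r \<i>" by (simp only: add scaleR) simp
    then show ?thesis by (auto simp: complex_eq_iff field_simps)
  qed
  show ?case unfolding eq by (intro cspan_add cspan_scaled_base)
next
  case (const c)
  show ?case using cspan_scaled_base[of c trig 0] by simp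
qed (auto intro: cspan_add trig_span_mult)

lemma trig_span_polynomial:
  fixes g :: "complex \<Rightarrow> complex"
  assumes "polynomial_function g"
  shows "(\<lambda>x. g (cis x)) \<in> cspan trig"
proof -
  have "real_polynomial_function (\<lambda>z. Re (g z))" "real_polynomial_function (\<lambda>z. Im (g z))"
    using assms by (auto simp: polynomial_function_def o_def bounded_linear_Re bounded_linear_Im)
  note rp = this[THEN trig_span_real_polynomial]
  have "(\<lambda>x::real. \<i>) \<in> cspan trig" using cspan_scaled_base[of \<i> trig 0] by simp
  from trig_span_mult[OF this rp(2)] cspan_add[OF rp(1)]
  have "(\<lambda>x. complex_of_real (Re (g (cis x))) + \<i> * complex_of_real (Im (g (cis x)))) \<in> cspan trig"
    by blast
  then show ?thesis by (simp flip: complex_eq)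
qed

text \<open>
Because the end values agree, \<open>c\<close> descends to a function \<open>C\<close> on the unit circle. It is continuous
since the closed interval is compact: preimages of closed sets under \<open>C\<close> are images of compact sets
under \<open>cis\<close>. The Stone-Weierstrass theorem on the circle then provides the polynomial.
\<close>

lemma trigonometric_Weierstrass:
  fixes c :: "real \<Rightarrow> complex"
  assumes cont: "continuous_on {a..a + 2 * pi} c" and ends: "c a = c (a + 2 * pi)" and "0 < \<epsilon>"
  obtains p where "p \<in> cspan trig" "\<And>x. x \<in> {a..a + 2 * pi} \<Longrightarrow> norm (c x - p x) < \<epsilon>"
proof -
  let ?I = "{a..a + 2 * pi}"
  define C where "C = (\<lambda>z. c (SOME x. x \<in> ?I \<and> cis x = z))"
  have same: "c x = c y" if x: "x \<in> ?I" and y: "y \<in> ?I" and eq: "cis x = cis y" for x y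
  proof -
    from eq have "sin x = sin y \<and> cos x = cos y" by (simp add: complex_eq_iff)
    then obtain n :: int where n: "x = y + 2 * pi * n" by (auto simp: sin_cos_eq_iff)
    have "2 * pi * n \<le> 2 * pi * 1" "2 * pi * (- 1) \<le> 2 * pi * n"
      using x y n unfolding atLeastAtMost_iff by linarith+
    from this[THEN mult_left_le_imp_le] have "real_of_int n \<le> 1" "- 1 \<le> real_of_int n" by simp_all
    then have "n = 0 \<or> n = 1 \<or> n = -1" by linarith
    then show ?thesis
    proof (elim disjE)
      assume "n = 1"
      with n have "x = y + 2 * pi" by simp
      with x y have "x = a + 2 * pi" "y = a" unfolding atLeastAtMost_iff by linarith+
      with ends show ?thesis by simp
    next
      assume "n = -1"
      with n have "x = y - 2 * pi" by simp
      with x y have "y = a + 2 * pi" "x = a" unfolding atLeastAtMost_iff by linarith+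
      with ends show ?thesis by simp
    qed (use n in simp)
  qed
  have C: "C (cis x) = c x" if "x \<in> ?I" for x
  proof -
    have "\<exists>y. y \<in> ?I \<and> cis y = cis x" using that by blast
    then have "(SOME y. y \<in> ?I \<and> cis y = cis x) \<in> ?I \<and> cis (SOME y. y \<in> ?I \<and> cis y = cis x) = cis x"
      by (rule someI_ex)
    then show ?thesis unfolding C_def using same that by blast
  qed
  have circle: "sphere 0 1 = cis ` ?I"
  proof (intro set_eqI iffI)
    fix z :: complex assume "z \<in> sphere 0 1"
    then have z: "z = cis (Arg z)" by (subst cis_Arg) (auto simp: sgn_div_norm)
    define n where "n = \<lceil>(a - Arg z) / (2 * pi)\<rceil>"
    have "(a - Arg z) / (2 * pi) \<le> n" "n < (a - Arg z) / (2 * pi) + 1" unfolding n_def by linarith+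
    then have "a - Arg z \<le> n * (2 * pi)" "n * (2 * pi) < a - Arg z + 2 * pi"
      by (simp_all add: field_simps)
    then have "Arg z + 2 * pi * n \<in> ?I" by (auto simp: algebra_simps)
    moreover have "cis (Arg z + 2 * pi * n) = z"
      using z by (simp flip: cis_mult add: cis_multiple_2pi[OF Ints_of_int])
    ultimately show "z \<in> cis ` ?I" by (metis imageI)
  qed (auto simp: dist_norm)
  have "continuous_on (sphere 0 1) C"
    unfolding continuous_on_closed_vimage[OF closed_sphere]
  proof (intro allI impI)
    fix B :: "complex set" assume "closed B"
    then have "closed (c -` B \<inter> ?I)"
      using cont unfolding continuous_on_closed_vimage[OF closed_atLeastAtMost] by blast
    then have "compact (?I \<inter> (c -` B \<inter> ?I))" by (intro compact_Int_closed) auto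
    then have "compact (cis ` (?I \<inter> (c -` B \<inter> ?I)))"
      by (intro compact_continuous_image continuous_on_cis continuous_on_id)
    moreover have "C -` B \<inter> sphere 0 1 = cis ` (?I \<inter> (c -` B \<inter> ?I))"
      unfolding circle using C by auto
    ultimately show "closed (C -` B \<inter> sphere 0 1)" by (simp add: compact_imp_closed)
  qed
  from Stone_Weierstrass_polynomial_function[OF compact_sphere this \<open>0 < \<epsilon>\<close>]
  obtain g where g: "polynomial_function g" "\<And>z. z \<in> sphere 0 1 \<Longrightarrow> norm (C z - g z) < \<epsilon>" by blast
  show ?thesis
  proof
    show "(\<lambda>x. g (cis x)) \<in> cspan trig" by (rule trig_span_polynomial[OF g(1)])
    show "norm (c x - g (cis x)) < \<epsilon>" if "x \<in> ?I" for x
      using g(2)[of "cis x"] C[OF that] by simp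
  qed
qed

lemma trig_span_measurable: "p \<in> cspan trig \<Longrightarrow> p \<in> borel_measurable borel"
  by (induction rule: cspan.induct) simp_all

text \<open>
Continuous approximations are multiplied by cut-offs that vanish at both end points and increase
to the constant one inside, so that the periodic Weierstrass theorem applies to them.
\<close>

lemma trigonometric_polynomials_dense:
  fixes f :: "real \<Rightarrow> complex" and a :: real
  defines "P \<equiv> {a..<a + 2 * pi}"
  assumes f [measurable]: "f \<in> borel_measurable lebesgue" and M: "\<And>x. norm (f x) \<le> M"
  shows "(\<lambda>x. indicator P x *\<^sub>R f x) \<in> L2_closure {\<lambda>x. indicator P x *\<^sub>R p x | p. p \<in> cspan trig}"
proof (rule L2_closure_trans)
  let ?C = "{\<lambda>x. indicator P x *\<^sub>R c x | c. continuous_on UNIV c \<and> c a = 0 \<and> c (a + 2 * pi) = 0}"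
  have P [measurable]: "P \<in> sets lebesgue" and P_borel [measurable]: "P \<in> sets borel" by (simp_all add: P_def)
  have P_emeasure: "emeasure lebesgue P = ennreal (2 * pi)"
    unfolding P_def by (simp add: emeasure_lborel_Ico)
  obtain c where c: "\<And>n. continuous_on UNIV (c n)" "\<And>n x. norm (c n x) \<le> M"
      "AE x in lebesgue. (\<lambda>n. c n x) \<longlonglongrightarrow> f x"
    using bounded_measurable_continuous_approximation[OF f M] by blast
  \<comment> \<open>The quadratic factor is positive exactly on the open interval.\<close>
  define w where "w = (\<lambda>(n::nat) x. max 0 (min 1 (real n * ((x - a) * (a + 2 * pi - x)))))"
  have w: "continuous_on UNIV (w n)" "0 \<le> w n x" "w n x \<le> 1" for n x
    unfolding w_def by (auto intro!: continuous_intros)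
  have w_lim: "(\<lambda>n. w n x) \<longlonglongrightarrow> 1" if "x \<in> P" "x \<noteq> a" for x
  proof (rule tendsto_eventually)
    from that have pos: "0 < (x - a) * (a + 2 * pi - x)" by (auto simp: P_def)
    then obtain N :: nat where N: "1 < real N * ((x - a) * (a + 2 * pi - x))"
      using reals_Archimedean3 by blast
    show "\<forall>\<^sub>F n in sequentially. w n x = 1"
    proof (rule eventually_sequentiallyI[of N])
      fix n assume "N \<le> n"
      then have "real N * ((x - a) * (a + 2 * pi - x)) \<le> real n * ((x - a) * (a + 2 * pi - x))"
        using pos by (intro mult_right_mono) auto
      with N show "w n x = 1" by (simp add: w_def)
    qed
  qed
  have g_cont: "continuous_on UNIV (\<lambda>x. w n x *\<^sub>R c n x)" for n
    by (intro continuous_on_scaleR w c)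
  show "(\<lambda>x. indicator P x *\<^sub>R f x) \<in> L2_closure ?C"
  proof (rule L2_closure_dominated[where w = "\<lambda>x. M * indicator P x"])
    show "(\<lambda>x. indicator P x *\<^sub>R w n x *\<^sub>R c n x) \<in> ?C" for n
      using g_cont[of n] by (intro CollectI exI[of _ "\<lambda>x. w n x *\<^sub>R c n x"]) (auto simp: w_def)
    have g_meas: "(\<lambda>x. w n x *\<^sub>R c n x) \<in> borel_measurable lebesgue" for n
      by (intro borel_measurable_lebesgue borel_measurable_continuous_onI g_cont)
    show "(\<lambda>x. indicator P x *\<^sub>R w n x *\<^sub>R c n x) \<in> borel_measurable lebesgue" for n
      by (intro borel_measurable_scaleR[OF _ g_meas] borel_measurable_indicator P)
    show "(\<lambda>x. indicator P x *\<^sub>R f x) \<in> borel_measurable lebesgue"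
      by (intro borel_measurable_scaleR borel_measurable_indicator) measurable
    show "integrable lebesgue (\<lambda>x. (M * indicator P x)\<^sup>2)"
      by (rule square_integrable_indicator) (auto simp: P_emeasure)
    have "norm (w n x *\<^sub>R c n x) \<le> 1 * M" for n x
      unfolding norm_scaleR using w c by (intro mult_mono) auto
    then show "norm (indicator P x *\<^sub>R w n x *\<^sub>R c n x) \<le> M * indicator P x" for n x
      by (auto simp: indicator_def)
    have "AE x in lebesgue. x \<noteq> a" by (intro AE_completion AE_lborel_singleton)
    with c(3) show "AE x in lebesgue. (\<lambda>n. indicator P x *\<^sub>R w n x *\<^sub>R c n x) \<longlonglongrightarrow> indicator P x *\<^sub>R f x"
    proof eventually_elim
      case (elim x)
      show ?case
      proof (cases "x \<in> P")
        case True
        have "(\<lambda>n. w n x *\<^sub>R c n x) \<longlonglongrightarrow> 1 *\<^sub>R f x"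
          by (intro tendsto_scaleR w_lim True elim)
        then show ?thesis using True by simp
      qed simp
    qed
  qed (use M in \<open>auto simp: indicator_def\<close>)
  show "?C \<subseteq> L2_closure {\<lambda>x. indicator P x *\<^sub>R p x | p. p \<in> cspan trig}"
  proof clarify
    fix c :: "real \<Rightarrow> complex" assume c: "continuous_on UNIV c" "c a = 0" "c (a + 2 * pi) = 0"
    have "\<exists>p\<in>cspan trig. \<forall>x\<in>{a..a + 2 * pi}. norm (c x - p x) < inverse (real (Suc n))" for n
    proof -
      have "continuous_on {a..a + 2 * pi} c" "c a = c (a + 2 * pi)" "0 < inverse (real (Suc n))"
        using c continuous_on_subset by auto
      then show ?thesis by (rule trigonometric_Weierstrass) blast
    qed
    then obtain p where p: "\<And>n. p n \<in> cspan trig"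
      and close: "\<And>n x. x \<in> {a..a + 2 * pi} \<Longrightarrow> norm (c x - p n x) < inverse (real (Suc n))"
      by metis
    show "(\<lambda>x. indicator P x *\<^sub>R c x) \<in> L2_closure {\<lambda>x. indicator P x *\<^sub>R p x | p. p \<in> cspan trig}"
    proof (rule L2_closure_tendsto[where F = sequentially])
      show "(\<lambda>x. indicator P x *\<^sub>R p n x) \<in> {\<lambda>x. indicator P x *\<^sub>R p x | p. p \<in> cspan trig}" for n
        using p by blast
      have [measurable]: "c \<in> borel_measurable borel" "p n \<in> borel_measurable borel" for n
        using c p by (auto intro: borel_measurable_continuous_onI trig_span_measurable)
      show "(\<lambda>x. indicator P x *\<^sub>R p n x) \<in> borel_measurable lebesgue"
        "(\<lambda>x. indicator P x *\<^sub>R c x) \<in> borel_measurable lebesgue" for n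
        by (rule borel_measurable_lebesgue; measurable)+
      have "L2_dist_sq (\<lambda>x. indicator P x *\<^sub>R c x) (\<lambda>x. indicator P x *\<^sub>R p n x)
          \<le> ennreal ((inverse (real (Suc n)))\<^sup>2 * (2 * pi))" for n
      proof -
        have "L2_dist_sq (\<lambda>x. indicator P x *\<^sub>R c x) (\<lambda>x. indicator P x *\<^sub>R p n x)
          \<le> (\<integral>\<^sup>+ x. ennreal ((inverse (real (Suc n)))\<^sup>2) * indicator P x \<partial>lebesgue)"
          unfolding L2_dist_sq_def
        proof (rule nn_integral_mono)
          fix x
          show "ennreal ((cmod (indicator P x *\<^sub>R c x - indicator P x *\<^sub>R p n x))\<^sup>2)
            \<le> ennreal ((inverse (real (Suc n)))\<^sup>2) * indicator P x"
            using close[of x n] by (auto simp: indicator_def P_def intro!: ennreal_leI power_mono)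
        qed
        also have "\<dots> = ennreal ((inverse (real (Suc n)))\<^sup>2 * (2 * pi))"
          by (simp add: nn_integral_cmult_indicator P_emeasure ennreal_mult)
        finally show ?thesis .
      qed
      note bound = this
      have "(\<lambda>n. ennreal ((inverse (real (Suc n)))\<^sup>2 * (2 * pi))) \<longlonglongrightarrow> 0"
      proof -
        have "(\<lambda>n. (inverse (real (Suc n)))\<^sup>2 * (2 * pi)) \<longlonglongrightarrow> 0\<^sup>2 * (2 * pi)"
          by (intro tendsto_intros LIMSEQ_inverse_real_of_nat)
        from tendsto_ennrealI[OF this] show ?thesis by simp
      qed
      then show "(\<lambda>n. L2_dist_sq (\<lambda>x. indicator P x *\<^sub>R c x) (\<lambda>x. indicator P x *\<^sub>R p n x)) \<longlonglongrightarrow> 0"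
        by (rule tendsto_sandwich[OF _ _ tendsto_const, rotated 2]) (use bound in auto)
    qed simp
  qed
qed

section \<open>Symmetries of the Fourier integral\<close>

lemma test_function_zero: "test_function (\<lambda>x. 0)"
  by (simp add: test_function_def)

lemma test_function_cmult:
  assumes "test_function h" shows "test_function (\<lambda>x. c * h x)"
  unfolding test_function_def
proof (intro conjI)
  obtain M where M: "\<And>x. norm (h x) \<le> M" using assms by (rule test_function_boundE) blast
  then have "norm (c * h x) \<le> norm c * M" for x by (simp add: norm_mult mult_left_mono)
  then show "bounded (range (\<lambda>x. c * h x))" by (auto simp: bounded_iff)
  have "AE x in lborel. isCont h x" using assms by (simp add: test_function_def)
  then show "AE x in lborel. isCont (\<lambda>x. c * h x) x"
    by eventually_elim (intro continuous_intros)
qed (use assms in simp)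

lemma test_function_add:
  assumes h: "test_function h" and k: "test_function k" shows "test_function (\<lambda>x. h x + k x)"
  unfolding test_function_def
proof (intro conjI)
  show "integrable lborel (\<lambda>x. h x + k x)" using h k by simp
  obtain M where M: "\<And>x. norm (h x) \<le> M" using h by (rule test_function_boundE) blast
  obtain N where N: "\<And>x. norm (k x) \<le> N" using k by (rule test_function_boundE) blast
  have "norm (h x + k x) \<le> M + N" for x using norm_triangle_le add_mono M N by blast
  then show "bounded (range (\<lambda>x. h x + k x))" by (auto simp: bounded_iff)
  have "AE x in lborel. isCont h x" "AE x in lborel. isCont k x" using h k by (simp_all add: test_function_def)
  then show "AE x in lborel. isCont (\<lambda>x. h x + k x) x"
    by eventually_elim (intro continuous_intros)
qed

lemma test_function_dilate:
  assumes h: "test_function h" and c: "c \<noteq> 0" shows "test_function (\<lambda>x. h (c * x))"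
  unfolding test_function_def
proof (intro conjI)
  show "integrable lborel (\<lambda>x. h (c * x))"
    using lborel_integrable_real_affine[OF test_function_integrable[OF h] c, of 0] by simp
  show "bounded (range (\<lambda>x. h (c * x)))"
    using h by (auto simp: test_function_def bounded_iff)
  have "AE x in lborel. isCont h x" using h by (simp add: test_function_def)
  from AE_borel_affine[OF c _ this, of 0] have "AE x in lborel. isCont h (c * x)" by simp
  then show "AE x in lborel. isCont (\<lambda>x. h (c * x)) x"
  proof eventually_elim
    case (elim x)
    show ?case by (rule isCont_o2[of _ "\<lambda>x. c * x" h]) (use elim in \<open>auto intro!: continuous_intros\<close>)
  qed
qed

lemma fourier_cmult: "fourier (\<lambda>s. c * h s) t = c * fourier h t"
proof -
  have "(\<lambda>s. cis (- (s * t)) * (c * h s)) = (\<lambda>s. c * (cis (- (s * t)) * h s))" by (simp add: mult_ac)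
  then show ?thesis by (simp add: fourier_def)
qed

lemma fourier_add:
  assumes "integrable lborel h" "integrable lborel k"
  shows "fourier (\<lambda>s. h s + k s) t = fourier h t + fourier k t"
  using integrable_cis_mult[OF assms(1), of "\<lambda>s. - (s * t)"] integrable_cis_mult[OF assms(2), of "\<lambda>s. - (s * t)"]
  by (simp add: fourier_def distrib_left)

lemma fourier_dilate:
  assumes "c > 0" shows "fourier (\<lambda>s. h (c * s)) t = fourier h (t / c) / c"
proof -
  have "(LINT s|lborel. cis (- (s * (t / c))) * h s) = c * (LINT s|lborel. cis (- (s * t)) * h (c * s))"
    using assms by (subst lborel_integral_real_affine[of c _ 0]) (auto simp: scaleR_conv_of_real)
  then show ?thesis using assms by (simp add: fourier_def)
qed

lemma fourier_modulate: "fourier (\<lambda>s. trig l s * h s) t = fourier h (t + of_int l)"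
proof -
  have "cis (- (s * t)) * (trig l s * h s) = cis (- (s * (t + of_int l))) * h s" for s
    unfolding mult.assoc[symmetric] cis_mult by (simp add: algebra_simps)
  then show ?thesis unfolding fourier_def by (simp only:)
qed

lemma L2_dist_sq_test_function:
  assumes "test_function (\<lambda>x. h x - k x)"
  shows "L2_dist_sq h k = ennreal (LINT s|lborel. (norm (h s - k s))\<^sup>2)"
  unfolding L2_dist_sq_def nn_integral_completion
  by (rule nn_integral_eq_integral[OF test_function_square_integrable[OF assms]]) simp

lemma test_function_diff: "test_function h \<Longrightarrow> test_function k \<Longrightarrow> test_function (\<lambda>x. h x - k x)"
  using test_function_add[of h "\<lambda>x. -1 * k x"] test_function_cmult[of k "-1"] by simp

lemma fourier_diff:
  assumes "integrable lborel h" "integrable lborel k"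
  shows "fourier (\<lambda>s. h s - k s) t = fourier h t - fourier k t"
  using fourier_add[OF assms(1), of "\<lambda>x. -1 * k x" t] fourier_cmult[of "-1" k t] assms(2) by simp

text \<open>
Plancherel's theorem for the difference of two test functions.
\<close>

lemma L2_dist_sq_fourier:
  assumes h: "test_function h" and k: "test_function k"
  shows "L2_dist_sq (\<lambda>t. fourier h (- t)) (\<lambda>t. fourier k (- t)) = L2_dist_sq h k"
proof -
  let ?d = "\<lambda>x. h x - k x"
  have d: "test_function ?d" using h k by (rule test_function_diff)
  have [measurable]: "fourier ?d \<in> borel_measurable borel" using d by simp
  have eq: "fourier h t - fourier k t = fourier ?d t" for t using h k by (simp add: fourier_diff)
  have "L2_dist_sq (\<lambda>t. fourier h (- t)) (\<lambda>t. fourier k (- t)) = (\<integral>\<^sup>+ t. ennreal ((cmod (fourier ?d (- t)))\<^sup>2) \<partial>lborel)"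
    unfolding L2_dist_sq_def nn_integral_completion by (simp only: eq)
  also have "\<dots> = (\<integral>\<^sup>+ t. ennreal ((cmod (fourier ?d t))\<^sup>2) \<partial>lborel)"
    by (subst (2) nn_integral_real_affine[of _ "-1" 0]) simp_all
  also have "\<dots> = ennreal (LINT t|lborel. (cmod (fourier ?d t))\<^sup>2)"
    by (rule nn_integral_eq_integral[OF Plancherel(1)[OF d]]) simp
  also have "\<dots> = L2_dist_sq h k"
    unfolding Plancherel(2)[OF d] L2_dist_sq_test_function[OF d] ..
  finally show ?thesis .
qed

section \<open>Mean closures of spans and dilates\<close>

lemma L2_closure_cspan_add:
  assumes f: "f \<in> L2_closure (cspan e)" and g: "g \<in> L2_closure (cspan e)"
  shows "(\<lambda>x. f x + g x) \<in> L2_closure (cspan e)"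
proof -
  have [measurable]: "f \<in> borel_measurable lebesgue" "g \<in> borel_measurable lebesgue"
    using f g by (auto simp: L2_closure_def)
  have "\<exists>h\<in>cspan e. h \<in> borel_measurable lebesgue \<and> L2_dist_sq (\<lambda>x. f x + g x) h < \<epsilon>" if "0 < \<epsilon>" for \<epsilon> :: ennreal
  proof -
    have e: "0 < \<epsilon> / 4" using that by (simp add: ennreal_zero_less_divide)
    obtain f' where f': "f' \<in> cspan e" "f' \<in> borel_measurable lebesgue" "L2_dist_sq f f' < \<epsilon> / 4"
      using f e by (auto simp: L2_closure_def)
    obtain g' where g': "g' \<in> cspan e" "g' \<in> borel_measurable lebesgue" "L2_dist_sq g g' < \<epsilon> / 4"
      using g e by (auto simp: L2_closure_def)
    note f'(2)[measurable] g'(2)[measurable]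
    have "L2_dist_sq (\<lambda>x. f x + g x) (\<lambda>x. f' x + g' x)
        \<le> 2 * L2_dist_sq (\<lambda>x. f x + g x) (\<lambda>x. f' x + g x) + 2 * L2_dist_sq (\<lambda>x. f' x + g x) (\<lambda>x. f' x + g' x)"
      by (rule L2_dist_sq_triangle) measurable
    also have "\<dots> = 2 * L2_dist_sq f f' + 2 * L2_dist_sq g g'"
      by (simp add: L2_dist_sq_def)
    also have "\<dots> < \<epsilon>" using ennreal_less_add_half that f' g' by blast
    finally show ?thesis using f' g' by (intro bexI[of _ "\<lambda>x. f' x + g' x"]) (auto intro: cspan_add)
  qed
  then show ?thesis by (simp add: L2_closure_def)
qed

lemma L2_closure_cspan_sum:
  assumes "\<And>n. n \<in> A \<Longrightarrow> f n \<in> L2_closure (cspan e)"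
  shows "(\<lambda>x. \<Sum>n\<in>A. f n x) \<in> L2_closure (cspan e)"
  using assms
proof (induction A rule: infinite_finite_induct)
  case (insert a A)
  then show ?case by (simp add: L2_closure_cspan_add)
qed (auto simp: L2_closure_def L2_dist_sq_def intro!: bexI[of _ "\<lambda>x. 0"] cspan_zero)

lemma L2_closure_dilate:
  assumes f: "f \<in> L2_closure S" "f \<in> borel_measurable borel" and S: "S \<subseteq> borel_measurable borel" and c: "c \<noteq> 0"
  shows "(\<lambda>x. f (c * x)) \<in> L2_closure ((\<lambda>g x. g (c * x)) ` S)"
proof -
  note f(2)[measurable]
  have "\<exists>h\<in>(\<lambda>g x. g (c * x)) ` S. h \<in> borel_measurable lebesgue \<and> L2_dist_sq (\<lambda>x. f (c * x)) h < \<epsilon>"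
    if "0 < \<epsilon>" for \<epsilon> :: ennreal
  proof -
    have "0 < ennreal \<bar>c\<bar> * \<epsilon>" using that c by (simp add: ennreal_zero_less_mult_iff)
    then obtain g where g: "g \<in> S" "L2_dist_sq f g < ennreal \<bar>c\<bar> * \<epsilon>" using f by (auto simp: L2_closure_def)
    have [measurable]: "g \<in> borel_measurable borel" using g S by auto
    have "L2_dist_sq f g = ennreal \<bar>c\<bar> * L2_dist_sq (\<lambda>x. f (c * x)) (\<lambda>x. g (c * x))"
      unfolding L2_dist_sq_def nn_integral_completion
      by (subst nn_integral_real_affine[OF _ c, of _ 0]) simp_all
    with g(2) have "L2_dist_sq (\<lambda>x. f (c * x)) (\<lambda>x. g (c * x)) < \<epsilon>"
      by (metis mult_left_mono not_le zero_le)
    moreover have "(\<lambda>x. g (c * x)) \<in> borel_measurable lebesgue" by (rule borel_measurable_lebesgue) measurable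
    ultimately show ?thesis using g(1) by blast
  qed
  moreover have "(\<lambda>x. f (c * x)) \<in> borel_measurable lebesgue" by (rule borel_measurable_lebesgue) measurable
  ultimately show ?thesis by (simp add: L2_closure_def)
qed

section \<open>Sets that tile the line by translations\<close>

text \<open>
The multiple is a rounded quotient; a half-open interval makes it unique.
\<close>

lemma interval_tiles:
  fixes a x :: real
  shows "\<exists>!k::int. x + 2 * pi * of_int k \<in> {a..<a + 2 * pi}"
proof (rule ex_ex1I)
  define n where "n = \<lceil>(a - x) / (2 * pi)\<rceil>"
  have "(a - x) / (2 * pi) \<le> n" "n < (a - x) / (2 * pi) + 1" unfolding n_def by linarith+
  then have "a - x \<le> n * (2 * pi)" "n * (2 * pi) < a - x + 2 * pi"
    by (simp_all add: field_simps)
  then show "\<exists>k::int. x + 2 * pi * of_int k \<in> {a..<a + 2 * pi}"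
    by (intro exI[of _ n]) (auto simp: algebra_simps)
next
  fix k l :: int
  assume "x + 2 * pi * of_int k \<in> {a..<a + 2 * pi}" "x + 2 * pi * of_int l \<in> {a..<a + 2 * pi}"
  then have "2 * pi * of_int k < 2 * pi * (of_int l + 1)" "2 * pi * of_int l < 2 * pi * (of_int k + 1)"
    unfolding atLeastLessThan_iff distrib_left by linarith+
  then have "real_of_int k < of_int l + 1" "real_of_int l < of_int k + 1" by simp_all
  then show "k = l" by linarith
qed

lemma translation_rep_eqI:
  assumes "\<exists>!k::int. x + 2 * pi * of_int k \<in> E" "x + 2 * pi * of_int k \<in> E"
  shows "translation_rep E x = x + 2 * pi * of_int k"
  unfolding translation_rep_def
proof (rule the_equality)
  show "x + 2 * pi * of_int k \<in> E \<and> (\<exists>l::int. x - (x + 2 * pi * of_int k) = 2 * pi * of_int l)"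
    using assms(2) by (auto intro!: exI[of _ "-k"])
  fix y assume y: "y \<in> E \<and> (\<exists>l::int. x - y = 2 * pi * of_int l)"
  then obtain l :: int where "y = x + 2 * pi * of_int (- l)" by (auto simp: algebra_simps)
  with y assms show "y = x + 2 * pi * of_int k" by metis
qed

lemma emeasure_translate:
  fixes c :: real assumes "B \<in> sets borel"
  shows "emeasure lborel {x. x + c \<in> B} = emeasure lborel B"
proof -
  have "emeasure lborel B = emeasure (distr lborel borel ((+) c)) B" by (simp only: lborel_distr_plus)
  also have "\<dots> = emeasure lborel {x. x + c \<in> B}"
    using assms by (subst emeasure_distr) (auto simp: vimage_def add.commute)
  finally show ?thesis ..
qed

locale translation_tile =
  fixes E :: "real set"
  assumes E_borel [measurable]: "E \<in> sets borel"
    and translation_tiles: "\<And>x. \<exists>!k::int. x + 2 * pi * of_int k \<in> E"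
begin

lemma translation_rep_props:
  obtains k :: int where "translation_rep E x = x + 2 * pi * of_int k" "translation_rep E x \<in> E"
  using translation_tiles[of x] translation_rep_eqI[of x E] by metis

lemma translation_rep_in_iff:
  "translation_rep E x \<in> A \<longleftrightarrow> (\<exists>k::int. x + 2 * pi * of_int k \<in> E \<inter> A)"
  using translation_rep_eqI[OF translation_tiles[of x]] translation_tiles[of x] by (metis IntE IntI)

lemma measurable_translation_rep [measurable]: "translation_rep E \<in> borel_measurable borel"
proof (rule borel_measurableI)
  fix S :: "real set" assume "open S"
  then have [measurable]: "S \<in> sets borel" by simp
  have "translation_rep E -` S = (\<Union>k::int. {x. x + 2 * pi * of_int k \<in> E \<inter> S})"
    by (auto simp: translation_rep_in_iff)
  also have "\<dots> \<in> sets borel" by measurable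
  finally show "translation_rep E -` S \<inter> space borel \<in> sets borel" by simp
qed

text \<open>
Sending a point of \<open>[a, a + 2\<pi>)\<close> to the congruent point of \<open>E\<close> preserves Lebesgue measure: it
is piecewise a translation, with countably many pieces \<open>(E - 2\<pi>k) \<inter> [a, a + 2\<pi>)\<close> whose
translates partition \<open>E\<close>.
\<close>

lemma distr_translation_rep:
  "distr (density lborel (indicator {a..<a + 2 * pi})) borel (translation_rep E) = density lborel (indicator E)"
    (is "?L = ?R")
proof (rule measure_eqI)
  let ?P = "{a..<a + 2 * pi}"
  fix A assume "A \<in> sets ?L"
  then have [measurable]: "A \<in> sets borel" by simp
  have "emeasure ?L A = emeasure lborel ({x. translation_rep E x \<in> A} \<inter> ?P)"
    by (simp add: emeasure_distr emeasure_density vimage_def indicator_inter_arith[symmetric] mult.commute flip: indicator_inter_arith)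
  also have "{x. translation_rep E x \<in> A} \<inter> ?P = (\<Union>k::int. {x. x + 2 * pi * of_int k \<in> E \<inter> A} \<inter> ?P)"
    by (auto simp: translation_rep_in_iff)
  also have "emeasure lborel \<dots> = (\<integral>\<^sup>+k. emeasure lborel ({x. x + 2 * pi * of_int k \<in> E \<inter> A} \<inter> ?P) \<partial>count_space UNIV)"
  proof (rule emeasure_UN_countable)
    show "disjoint_family (\<lambda>k::int. {x. x + 2 * pi * of_int k \<in> E \<inter> A} \<inter> ?P)"
      using translation_tiles by (auto simp: disjoint_family_on_def)
  qed auto
  also have "\<dots> = (\<integral>\<^sup>+k. emeasure lborel (E \<inter> A \<inter> {x. x + 2 * pi * of_int (- k) \<in> ?P}) \<partial>count_space UNIV)"
  proof (rule nn_integral_cong)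
    fix k :: int
    have "{x. x + 2 * pi * of_int k \<in> E \<inter> A} \<inter> ?P =
      {x. x + 2 * pi * of_int k \<in> E \<inter> A \<inter> {x. x + 2 * pi * of_int (- k) \<in> ?P}}"
      by auto
    then show "emeasure lborel ({x. x + 2 * pi * of_int k \<in> E \<inter> A} \<inter> ?P) =
      emeasure lborel (E \<inter> A \<inter> {x. x + 2 * pi * of_int (- k) \<in> ?P})"
      by (simp only:) (rule emeasure_translate, measurable)
  qed
  also have "\<dots> = emeasure lborel (\<Union>k::int. E \<inter> A \<inter> {x. x + 2 * pi * of_int (- k) \<in> ?P})"
  proof (rule emeasure_UN_countable[symmetric])
    show "disjoint_family (\<lambda>k::int. E \<inter> A \<inter> {x. x + 2 * pi * of_int (- k) \<in> ?P})"
      unfolding disjoint_family_on_def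
    proof (intro ballI impI)
      fix k l :: int assume "k \<noteq> l"
      have "\<not> (x + 2 * pi * of_int (- k) \<in> ?P \<and> x + 2 * pi * of_int (- l) \<in> ?P)" for x
        using interval_tiles[of x a] \<open>k \<noteq> l\<close> by (metis neg_equal_iff_equal)
      then show "(E \<inter> A \<inter> {x. x + 2 * pi * of_int (- k) \<in> ?P}) \<inter> (E \<inter> A \<inter> {x. x + 2 * pi * of_int (- l) \<in> ?P}) = {}"
        by blast
    qed
  qed auto
  also have "(\<Union>k::int. E \<inter> A \<inter> {x. x + 2 * pi * of_int (- k) \<in> ?P}) = E \<inter> A"
  proof -
    have "\<exists>k::int. x + 2 * pi * of_int (- k) \<in> ?P" for x
      using interval_tiles[of x a] by (metis minus_minus)
    then show ?thesis by blast
  qed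
  also have "emeasure lborel (E \<inter> A) = emeasure ?R A"
    by (simp add: emeasure_density flip: indicator_inter_arith)
  finally show "emeasure ?L A = emeasure ?R A" .
qed simp

lemma nn_integral_tile:
  assumes [measurable]: "u \<in> borel_measurable borel"
  shows "(\<integral>\<^sup>+x. indicator E x * u x \<partial>lborel) =
    (\<integral>\<^sup>+x. indicator {a..<a + 2 * pi} x * u (translation_rep E x) \<partial>lborel)"
proof -
  have "(\<integral>\<^sup>+x. indicator E x * u x \<partial>lborel) = (\<integral>\<^sup>+x. u x \<partial>density lborel (indicator E))"
    by (subst nn_integral_density) simp_all
  also have "\<dots> = (\<integral>\<^sup>+x. u (translation_rep E x) \<partial>density lborel (indicator {a..<a + 2 * pi}))"
    by (subst distr_translation_rep[of a, symmetric], subst nn_integral_distr) simp_all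
  also have "\<dots> = (\<integral>\<^sup>+x. indicator {a..<a + 2 * pi} x * u (translation_rep E x) \<partial>lborel)"
    by (subst nn_integral_density) simp_all
  finally show ?thesis .
qed

lemma integral_tile:
  fixes u :: "real \<Rightarrow> complex"
  assumes [measurable]: "u \<in> borel_measurable borel"
  shows "(LINT x|lborel. indicator E x *\<^sub>R u x) =
    (LINT x|lborel. indicator {a..<a + 2 * pi} x *\<^sub>R u (translation_rep E x))"
proof -
  have i: "indicator A x = ennreal (indicator A x)" for A and x :: real by (simp add: indicator_def)
  have "(LINT x|lborel. indicator E x *\<^sub>R u x) = (LINT x|density lborel (indicator E). u x)"
    unfolding i by (subst integral_density) simp_all
  also have "\<dots> = (LINT x|density lborel (indicator {a..<a + 2 * pi}). u (translation_rep E x))"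
    by (subst distr_translation_rep[of a, symmetric], subst integral_distr) simp_all
  also have "\<dots> = (LINT x|lborel. indicator {a..<a + 2 * pi} x *\<^sub>R u (translation_rep E x))"
    unfolding i by (subst integral_density) simp_all
  finally show ?thesis .
qed

lemma trig_translation_rep: "trig l (translation_rep E x) = trig l x"
proof -
  obtain k :: int where k: "translation_rep E x = x + 2 * pi * of_int k" by (rule translation_rep_props)
  have "trig l (x + 2 * pi * of_int k) = trig l x * cis (2 * pi * of_int (- (l * k)))"
    unfolding cis_mult by (simp add: algebra_simps)
  also have "cis (2 * pi * of_int (- (l * k))) = 1" by (rule cis_multiple_2pi) simp
  finally show ?thesis by (simp add: k)
qed

lemma trig_span_translation_rep: "p \<in> cspan trig \<Longrightarrow> p (translation_rep E x) = p x"
  by (induction rule: cspan.induct) (simp_all only: trig_translation_rep)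

text \<open>
The exponentials are \<open>2\<pi>\<close>-periodic, so their integrals over \<open>E\<close> and over \<open>[0, 2\<pi>)\<close> agree.
\<close>

lemma integral_trig_tile:
  "(LINT x|lborel. indicator E x *\<^sub>R trig l x) = (if l = 0 then 2 * pi else 0)"
proof -
  have "(LINT x|lborel. indicator E x *\<^sub>R trig l x) = (LINT x|lborel. indicator {0..<0 + 2 * pi} x *\<^sub>R trig l x)"
    by (subst integral_tile[of _ 0]) (simp_all only: trig_translation_rep, measurable)
  also have "\<dots> = (LINT x|lborel. indicator {0..2 * pi} x *\<^sub>R trig l x)"
  proof (rule integral_cong_AE)
    have "AE x in lborel. x \<noteq> 2 * pi" by (rule AE_lborel_singleton)
    then show "AE x in lborel. indicator {0..<0 + 2 * pi} x *\<^sub>R trig l x = indicator {0..2 * pi} x *\<^sub>R trig l x"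
      by eventually_elim (auto simp: indicator_def)
  qed measurable
  also have "\<dots> = (if l = 0 then 2 * pi else 0)"
  proof (cases "l = 0")
    case True
    then show ?thesis by (simp add: scaleR_conv_of_real)
  next
    case False
    let ?F = "\<lambda>x. \<i> / of_int l * trig l x"
    have "(LINT x|lborel. indicator {0..2 * pi} x *\<^sub>R trig l x) = ?F (2 * pi) - ?F 0"
    proof (rule integral_FTC_atLeastAtMost)
      fix x
      have "((\<lambda>z. \<i> / of_int l * exp (- (\<i> * of_int l * z))) has_field_derivative
          exp (- (\<i> * of_int l * of_real x))) (at (of_real x))"
        using False by (auto intro!: derivative_eq_intros)
      from has_vector_derivative_real_field[OF this, of "{0..2 * pi}"]
      show "(?F has_vector_derivative trig l x) (at x within {0..2 * pi})"
        by (simp add: cis_conv_exp mult.assoc)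
    qed (auto intro!: continuous_intros simp: cis_conv_exp)
    also have "trig l (2 * pi) = 1"
      using cis_multiple_2pi[of "of_int (- l)"] by (simp add: mult_ac)
    finally show ?thesis using False by simp
  qed
  finally show ?thesis .
qed

end

lemma L2_closureE:
  assumes "f \<in> L2_closure S" "0 < \<epsilon>"
  obtains g where "g \<in> S" "g \<in> borel_measurable lebesgue" "L2_dist_sq f g < \<epsilon>"
  using assms unfolding L2_closure_def by blast

section \<open>Sets that tile by translations and by dilations are wavelet sets\<close>

text \<open>
A null frontier makes the indicator of \<open>E\<close> continuous almost everywhere. With zero excluded, every
real number lies in at most one of the dilates of \<open>E\<close>.
\<close>

locale wavelet_tile = translation_tile +
  assumes frontier_null: "AE x in lborel. x \<notin> frontier E"
    and zero_notin: "0 \<notin> E"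
    and dilation_tiles: "\<And>s. s \<noteq> 0 \<Longrightarrow> \<exists>!n::int. 2 powi n * s \<in> E"
begin

lemma emeasure_E: "emeasure lborel E = ennreal (2 * pi)"
proof -
  have "emeasure lborel E = (\<integral>\<^sup>+x. indicator {0..<0 + 2 * pi} x \<partial>lborel)"
    using nn_integral_tile[of "\<lambda>_. 1" 0] by simp
  then show ?thesis by (simp del: add_0 add: emeasure_lborel_Ico)
qed

lemma test_function_tile_trig: "test_function (\<lambda>x. indicator E x *\<^sub>R trig l x)"
proof (rule test_function_scaleR_indicator[OF E_borel _ frontier_null])
  have "continuous_on UNIV (trig l)"
    unfolding cis_conv_exp by (intro continuous_intros)
  then show "AE x in lborel. isCont (trig l) x"
    by (simp add: continuous_on_eq_continuous_at)
qed (auto simp: emeasure_E intro!: order.refl)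

text \<open>
The Fourier transform of the member \<open>(n, l)\<close> of the dyadic family; it is supported on \<open>2^n E\<close>. See
lemma \<open>fourier_wavelet_hat\<close>.
\<close>

definition wavelet_hat :: "int \<times> int \<Rightarrow> real \<Rightarrow> complex" where
  "wavelet_hat = (\<lambda>(n, l) s. complex_of_real (2 powr (- real_of_int n / 2) / sqrt (2 * pi)) *
     (indicator E (2 powi (- n) * s) *\<^sub>R trig l (2 powi (- n) * s)))"

definition wavelet :: "real \<Rightarrow> complex" where
  "wavelet t = fourier (\<lambda>s. complex_of_real (1 / sqrt (2 * pi) * indicator E s)) (- t)"

lemma test_function_wavelet_hat: "test_function (wavelet_hat i)"
proof (cases i)
  case (Pair n l)
  have "test_function (\<lambda>s. complex_of_real (2 powr (- real_of_int n / 2) / sqrt (2 * pi)) *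
     (indicator E (2 powi (- n) * s) *\<^sub>R trig l (2 powi (- n) * s)))"
    by (rule test_function_cmult, rule test_function_dilate[OF test_function_tile_trig]) simp
  then show ?thesis by (simp add: wavelet_hat_def Pair)
qed

lemma test_function_wavelet_hat_span: "q \<in> cspan wavelet_hat \<Longrightarrow> test_function q"
  by (induction rule: cspan.induct) (simp_all add: test_function_zero test_function_add test_function_cmult test_function_wavelet_hat)

lemma wavelet_hat_zero: "wavelet_hat (0, 0) = (\<lambda>s. complex_of_real (1 / sqrt (2 * pi) * indicator E s))"
  by (simp add: wavelet_hat_def scaleR_conv_of_real fun_eq_iff)

lemma powr_half_mult_powi: "2 powr (- real_of_int n / 2) * 2 powi n = (2::real) powr (real_of_int n / 2)"
proof -
  have "(2::real) powi n = 2 powr real_of_int n" by (simp add: powr_real_of_int')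
  then show ?thesis by (simp flip: powr_add)
qed

lemma fourier_wavelet_hat: "fourier (wavelet_hat i) (- t) = dyadic_family wavelet i t"
proof (cases i)
  case (Pair n l)
  let ?g = "wavelet_hat (0, 0)"
  have "wavelet_hat (n, l) = (\<lambda>s. complex_of_real (2 powr (- real_of_int n / 2)) *
      (\<lambda>x. trig l x * ?g x) (2 powi (- n) * s))"
    by (simp add: wavelet_hat_def scaleR_conv_of_real fun_eq_iff)
  then have "fourier (wavelet_hat (n, l)) (- t) = complex_of_real (2 powr (- real_of_int n / 2)) *
      fourier (\<lambda>s. (\<lambda>x. trig l x * ?g x) (2 powi (- n) * s)) (- t)"
    by (simp only: fourier_cmult)
  also have "\<dots> = complex_of_real (2 powr (- real_of_int n / 2)) *
      (fourier (\<lambda>x. trig l x * ?g x) (- t / 2 powi (- n)) / complex_of_real (2 powi (- n)))"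
    by (subst fourier_dilate) simp_all
  also have "\<dots> = complex_of_real (2 powr (- real_of_int n / 2) * 2 powi n) * fourier ?g (- t / 2 powi (- n) + of_int l)"
    unfolding fourier_modulate by (simp add: power_int_minus divide_simps)
  also have "\<dots> = complex_of_real (2 powr (real_of_int n / 2)) * fourier ?g (- (2 powi n * t - of_int l))"
    unfolding powr_half_mult_powi by (simp add: power_int_minus divide_simps mult.commute)
  finally show ?thesis by (simp add: Pair dyadic_family_def wavelet_def wavelet_hat_zero)
qed

lemma dilation_unique:
  assumes "s \<noteq> 0" "2 powi m * s \<in> E" "2 powi n * s \<in> E" shows "m = n"
  using dilation_tiles[OF assms(1)] assms(2,3) by blast

text \<open>
Members of different levels have disjoint supports up to the point zero; on one level the claim is
the orthogonality of the exponentials on \<open>E\<close>, rescaled.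
\<close>

lemma wavelet_hat_orthonormal: "(LINT s|lborel. wavelet_hat i s * cnj (wavelet_hat j s)) = (if i = j then 1 else 0)"
proof -
  obtain n l m k where ij: "i = (n, l)" "j = (m, k)" by (cases i, cases j) auto
  show ?thesis
  proof (cases "n = m")
    case False
    have "AE s in lborel. s \<noteq> (0::real)" by (rule AE_lborel_singleton)
    then have "AE s in lborel. wavelet_hat i s * cnj (wavelet_hat j s) = 0"
    proof eventually_elim
      case (elim s)
      then show ?case using dilation_unique[of s "-n" "-m"] False
        by (auto simp: ij wavelet_hat_def indicator_def)
    qed
    then have "(LINT s|lborel. wavelet_hat i s * cnj (wavelet_hat j s)) = 0" by (rule integral_eq_zero_AE)
    then show ?thesis using False ij by simp
  next
    case True
    let ?C = "complex_of_real (2 powi (- n) / (2 * pi))"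
    have eq: "wavelet_hat i s * cnj (wavelet_hat j s) = ?C * (\<lambda>x. indicator E x *\<^sub>R trig (l - k) x) (2 powi (- n) * s)" for s
    proof -
      have scaled: "(complex_of_real c * (indicator E y *\<^sub>R u)) * cnj (complex_of_real c * (indicator E y *\<^sub>R v)) =
          complex_of_real (c * c) * (indicator E y *\<^sub>R (u * cnj v))" for c y u v
        by (simp add: indicator_def)
      have "trig l x * cnj (trig k x) = trig (l - k) x" for x
        unfolding cis_cnj cis_mult by (simp add: algebra_simps)
      moreover have "(2 powr (- real_of_int n / 2) / sqrt (2 * pi)) * (2 powr (- real_of_int n / 2) / sqrt (2 * pi))
        = 2 powi (- n) / (2 * pi)"
        using powr_real_of_int'[of 2 "- n"] by (simp flip: powr_add)
      moreover have "wavelet_hat i s * cnj (wavelet_hat j s) =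
          complex_of_real ((2 powr (- real_of_int n / 2) / sqrt (2 * pi)) * (2 powr (- real_of_int n / 2) / sqrt (2 * pi))) *
          (indicator E (2 powi (- n) * s) *\<^sub>R (trig l (2 powi (- n) * s) * cnj (trig k (2 powi (- n) * s))))"
        unfolding ij True[symmetric] wavelet_hat_def case_prod_conv by (rule scaled)
      ultimately show ?thesis by (simp only:)
    qed
    have "(LINT s|lborel. wavelet_hat i s * cnj (wavelet_hat j s)) =
        ?C * (LINT s|lborel. (\<lambda>x. indicator E x *\<^sub>R trig (l - k) x) (2 powi (- n) * s))"
      unfolding eq by (rule integral_mult_right_zero)
    also have "\<dots> = 1 / complex_of_real (2 * pi) * (LINT x|lborel. indicator E x *\<^sub>R trig (l - k) x)"
      by (subst (2) lborel_integral_real_affine[of "2 powi (- n)" _ 0]) (simp_all add: scaleR_conv_of_real)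
    also have "\<dots> = (if i = j then 1 else 0)"
      unfolding integral_trig_tile using True ij by simp
    finally show ?thesis .
  qed
qed

text \<open>
The part of \<open>k\<close> on one dilate of \<open>E\<close>: scale it back to \<open>E\<close>, transport it to \<open>[0, 2\<pi>)\<close> by the
measure-preserving translation map, approximate it there by a trigonometric polynomial, and return
along the same way, on which trigonometric polynomials do not change.
\<close>

lemma dilated_piece_in_closure:
  assumes k: "test_function k"
  shows "(\<lambda>s. indicator E (2 powi n * s) *\<^sub>R k s) \<in> L2_closure (cspan wavelet_hat)"
proof -
  have [measurable]: "k \<in> borel_measurable borel" using k by (rule test_function_measurable)
  obtain M where M: "\<And>x. norm (k x) \<le> M" using k by (rule test_function_boundE) blast
  let ?k = "\<lambda>x. k (2 powi (- n) * x)"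
  let ?v = "\<lambda>x. indicator E x *\<^sub>R ?k x"
  let ?P = "{0..<0 + 2 * pi}"
  let ?S = "{\<lambda>x. indicator E x *\<^sub>R p x | p. p \<in> cspan trig}"
  have S: "?S \<subseteq> borel_measurable borel"
  proof clarify
    fix p :: "real \<Rightarrow> complex" assume "p \<in> cspan trig"
    from trig_span_measurable[OF this] show "(\<lambda>x. indicator E x *\<^sub>R p x) \<in> borel_measurable borel" by measurable
  qed
  have v: "?v \<in> borel_measurable borel" by measurable
  have "?v \<in> L2_closure ?S"
    unfolding L2_closure_def
  proof (intro CollectI conjI allI impI)
    show "?v \<in> borel_measurable lebesgue" by (rule borel_measurable_lebesgue[OF v])
    fix \<epsilon> :: ennreal assume "0 < \<epsilon>"
    have "(\<lambda>x. indicator ?P x *\<^sub>R ?k (translation_rep E x)) \<in>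
        L2_closure {\<lambda>x. indicator ?P x *\<^sub>R p x | p. p \<in> cspan trig}"
      by (rule trigonometric_polynomials_dense[where M = M]) (auto simp: M intro!: borel_measurable_lebesgue)
    then obtain p where p: "p \<in> cspan trig"
      and close: "L2_dist_sq (\<lambda>x. indicator ?P x *\<^sub>R ?k (translation_rep E x)) (\<lambda>x. indicator ?P x *\<^sub>R p x) < \<epsilon>"
      using \<open>0 < \<epsilon>\<close> unfolding L2_closure_def by blast
    have [measurable]: "p \<in> borel_measurable borel" using p by (rule trig_span_measurable)
    have ind: "ennreal ((cmod (indicator A x *\<^sub>R y - indicator A x *\<^sub>R z))\<^sup>2) = indicator A x * ennreal ((cmod (y - z))\<^sup>2)"
      for A and x :: real and y z by (simp add: indicator_def)
    have "L2_dist_sq ?v (\<lambda>x. indicator E x *\<^sub>R p x) =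
        (\<integral>\<^sup>+x. indicator ?P x * ennreal ((cmod (?k (translation_rep E x) - p (translation_rep E x)))\<^sup>2) \<partial>lborel)"
      unfolding L2_dist_sq_def nn_integral_completion ind by (rule nn_integral_tile) measurable
    also have "\<dots> = L2_dist_sq (\<lambda>x. indicator ?P x *\<^sub>R ?k (translation_rep E x)) (\<lambda>x. indicator ?P x *\<^sub>R p x)"
      unfolding L2_dist_sq_def nn_integral_completion ind trig_span_translation_rep[OF p] ..
    finally have "L2_dist_sq ?v (\<lambda>x. indicator E x *\<^sub>R p x) < \<epsilon>" using close by simp
    then show "\<exists>g\<in>?S. g \<in> borel_measurable lebesgue \<and> L2_dist_sq ?v g < \<epsilon>"
      using p S borel_measurable_lebesgue by blast
  qed
  from L2_closure_dilate[OF this v S, of "2 powi n"]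
  have "(\<lambda>s. ?v (2 powi n * s)) \<in> L2_closure ((\<lambda>g x. g (2 powi n * x)) ` ?S)" by simp
  moreover have "(\<lambda>g x. g (2 powi n * x)) ` ?S \<subseteq> cspan wavelet_hat"
  proof clarify
    fix p :: "real \<Rightarrow> complex" assume "p \<in> cspan trig"
    then show "(\<lambda>x. indicator E (2 powi n * x) *\<^sub>R p (2 powi n * x)) \<in> cspan wavelet_hat"
    proof induction
      case cspan_zero
      show ?case using cspan.cspan_zero by simp
    next
      case (cspan_step p c l)
      let ?d = "c / complex_of_real (2 powr (- real_of_int (- n) / 2) / sqrt (2 * pi))"
      have "(\<lambda>x. indicator E (2 powi n * x) *\<^sub>R (p (2 powi n * x) + c * trig l (2 powi n * x))) =
        (\<lambda>x. indicator E (2 powi n * x) *\<^sub>R p (2 powi n * x) + ?d * wavelet_hat (- n, l) x)"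
        by (simp add: fun_eq_iff wavelet_hat_def scaleR_conv_of_real algebra_simps)
      with cspan.cspan_step[OF cspan_step(2), of ?d "(- n, l)"] show ?case by (simp only:)
    qed
  qed
  moreover have "?v (2 powi n * s) = indicator E (2 powi n * s) *\<^sub>R k s" for s
    by (simp add: power_int_minus flip: mult.assoc)
  moreover have "cspan wavelet_hat \<subseteq> L2_closure (cspan wavelet_hat)"
    using test_function_measurable[OF test_function_wavelet_hat_span] by (intro L2_closure_subset) (auto intro: borel_measurable_lebesgue)
  ultimately show ?thesis by (metis (no_types, lifting) L2_closure_trans order_trans ext)
qed

text \<open>
For every \<open>s \<noteq> 0\<close> exactly one of the dilates contains \<open>s\<close>, so finite sums of the pieces converge
pointwise almost everywhere and are dominated by \<open>\<bar>k\<bar>\<close>.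
\<close>

lemma wavelet_hat_complete:
  assumes k: "test_function k"
  shows "k \<in> L2_closure (cspan wavelet_hat)"
proof (rule L2_closure_trans)
  let ?g = "\<lambda>N s. \<Sum>n\<in>{-int N..int N}. indicator E (2 powi n * s) *\<^sub>R k s"
  let ?S = "range ?g"
  have k_borel [measurable]: "k \<in> borel_measurable borel" using k by (rule test_function_measurable)
  show "?S \<subseteq> L2_closure (cspan wavelet_hat)"
    by clarify (rule L2_closure_cspan_sum[OF dilated_piece_in_closure[OF k]])
  have sum_eq: "?g N s = (if n \<in> {-int N..int N} then k s else 0)"
    if "s \<noteq> 0" "2 powi n * s \<in> E" for N n s
  proof -
    have "indicator E (2 powi m * s) *\<^sub>R k s = (if m = n then k s else 0)" for m
      using dilation_unique[OF that(1)] that by (auto simp: indicator_def)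
    then show ?thesis by simp
  qed
  show "k \<in> L2_closure ?S"
  proof (rule L2_closure_dominated[where w = "\<lambda>x. norm (k x)"])
    show "?g N \<in> ?S" for N by blast
    show "k \<in> borel_measurable lebesgue" by (rule borel_measurable_lebesgue[OF k_borel])
    show "?g N \<in> borel_measurable lebesgue" for N
      by (rule borel_measurable_lebesgue) measurable
    show "integrable lebesgue (\<lambda>x. (norm (k x))\<^sup>2)"
      using test_function_square_integrable[OF k] by (simp add: integrable_completion)
    show "norm (?g N s) \<le> norm (k s)" for N s
    proof (cases "s = 0")
      case True
      then show ?thesis using zero_notin by simp
    next
      case False
      with dilation_tiles obtain n where "2 powi n * s \<in> E" by blast
      from sum_eq[OF False this] show ?thesis by simp
    qed
    have "AE s in lebesgue. s \<noteq> 0" by (intro AE_completion AE_lborel_singleton)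
    then show "AE s in lebesgue. (\<lambda>N. ?g N s) \<longlonglongrightarrow> k s"
    proof eventually_elim
      case (elim s)
      with dilation_tiles obtain n where n: "2 powi n * s \<in> E" by blast
      show ?case
        by (intro tendsto_eventually eventually_sequentiallyI[of "nat \<bar>n\<bar>"])
          (subst sum_eq[OF elim n], auto)
    qed
  qed simp
qed

lemma borel_measurable_wavelet [measurable]: "wavelet \<in> borel_measurable borel"
proof -
  have [measurable]: "fourier (wavelet_hat (0, 0)) \<in> borel_measurable borel" using test_function_wavelet_hat by simp
  then show ?thesis unfolding wavelet_def wavelet_hat_zero[symmetric] by measurable
qed

lemma dyadic_family_in_L2: "dyadic_family wavelet i \<in> L2_fun"
proof -
  have [measurable]: "fourier (wavelet_hat i) \<in> borel_measurable borel" using test_function_wavelet_hat by simp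
  have eq: "dyadic_family wavelet i = (\<lambda>t. fourier (wavelet_hat i) (- t))" by (simp add: fourier_wavelet_hat)
  have m: "(\<lambda>t. fourier (wavelet_hat i) (- t)) \<in> borel_measurable borel" by measurable
  have "integrable lborel (\<lambda>t. (cmod (fourier (wavelet_hat i) (- t)))\<^sup>2)"
    using lborel_integrable_real_affine[OF Plancherel(1)[OF test_function_wavelet_hat[of i]], of "-1" 0] by simp
  then show ?thesis
    unfolding L2_fun_def eq using borel_measurable_lebesgue[OF m] by (simp add: integrable_completion)
qed

lemma dyadic_family_zero: "dyadic_family wavelet (0, 0) = wavelet"
  by (simp add: dyadic_family_def fun_eq_iff)

lemma dyadic_family_orthonormal:
  "L2_inner (dyadic_family wavelet i) (dyadic_family wavelet j) = (if i = j then 1 else 0)"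
proof -
  have [measurable]: "fourier (wavelet_hat i) \<in> borel_measurable borel" for i using test_function_wavelet_hat by simp
  have eq: "dyadic_family wavelet i = (\<lambda>t. fourier (wavelet_hat i) (- t))" for i by (simp add: fourier_wavelet_hat)
  have "L2_inner (dyadic_family wavelet i) (dyadic_family wavelet j) =
      (LINT t|lborel. fourier (wavelet_hat i) (- t) * cnj (fourier (wavelet_hat j) (- t)))"
    unfolding L2_inner_def eq by (rule integral_completion) measurable
  also have "\<dots> = (LINT t|lborel. fourier (wavelet_hat i) t * cnj (fourier (wavelet_hat j) t))"
    by (subst (2) lborel_integral_real_affine[of "-1" _ 0]) simp_all
  finally show ?thesis by (simp add: Parseval test_function_wavelet_hat wavelet_hat_orthonormal)
qed

text \<open>
Approximate \<open>f\<close> by the Fourier integral of a test function \<open>k\<close> and \<open>k\<close> by a combination of the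
functions \<open>wavelet_hat i\<close>; the Fourier integral preserves the second distance.
\<close>

lemma dyadic_family_complete:
  assumes f: "f \<in> L2_fun"
  shows "f \<in> L2_closure (cspan (dyadic_family wavelet))"
proof (rule L2_closure_trans[OF Fourier_images_dense[OF f]], clarify)
  fix k assume k: "test_function k"
  have [measurable]: "fourier k \<in> borel_measurable borel" using k by simp
  have "\<exists>g\<in>cspan (dyadic_family wavelet). g \<in> borel_measurable lebesgue \<and> L2_dist_sq (\<lambda>t. fourier k (- t)) g < \<epsilon>"
    if e: "0 < \<epsilon>" for \<epsilon> :: ennreal
  proof -
    obtain q where q: "q \<in> cspan wavelet_hat" and close: "L2_dist_sq k q < \<epsilon>"
      using L2_closureE[OF wavelet_hat_complete[OF k] e] by blast
    have qn: "test_function q" by (rule test_function_wavelet_hat_span[OF q])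
    have [measurable]: "fourier q \<in> borel_measurable borel" using qn by simp
    have "(\<lambda>t. fourier q (- t)) \<in> cspan (dyadic_family wavelet)"
      using q
    proof induction
      case cspan_zero
      show ?case using cspan.cspan_zero by (simp add: fourier_def)
    next
      case (cspan_step p c i)
      have "(\<lambda>t. fourier (\<lambda>x. p x + c * wavelet_hat i x) (- t)) = (\<lambda>t. fourier p (- t) + c * dyadic_family wavelet i t)"
        using test_function_wavelet_hat_span[OF cspan_step(1)] test_function_wavelet_hat[of i]
        by (subst fourier_add) (simp_all add: test_function_cmult fourier_cmult fourier_wavelet_hat)
      with cspan.cspan_step[OF cspan_step(2)] show ?case by (simp only:)
    qed
    moreover have "(\<lambda>t. fourier q (- t)) \<in> borel_measurable lebesgue"
      by (rule borel_measurable_lebesgue) measurable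
    ultimately show ?thesis using close L2_dist_sq_fourier[OF k qn] by (metis (no_types, lifting))
  qed
  moreover have "(\<lambda>t. fourier k (- t)) \<in> borel_measurable lebesgue"
    by (rule borel_measurable_lebesgue) measurable
  ultimately show "(\<lambda>t. fourier k (- t)) \<in> L2_closure (cspan (dyadic_family wavelet))"
    by (simp add: L2_closure_def)
qed

lemma orthonormal_basis_dyadic_family: "orthonormal_basis_L2 (dyadic_family wavelet)"
  unfolding orthonormal_basis_L2_def
proof (intro conjI allI ballI impI)
  fix f and \<epsilon> :: real assume f: "f \<in> L2_fun" and "0 < \<epsilon>"
  then obtain g where g: "g \<in> cspan (dyadic_family wavelet)" "g \<in> borel_measurable lebesgue"
    and close: "L2_dist_sq f g < ennreal (\<epsilon>\<^sup>2)"
    using L2_closureE[OF dyadic_family_complete[OF f], of "ennreal (\<epsilon>\<^sup>2)"] by (auto simp: ennreal_less_zero_iff)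
  obtain I c where I: "finite I" and g_eq: "g = (\<lambda>t. \<Sum>i\<in>I. c i * dyadic_family wavelet i t)"
    using cspan_imp_finite_sum[OF g(1)] by blast
  note g(2)[measurable]
  have [measurable]: "f \<in> borel_measurable lebesgue" using f by (simp add: L2_fun_def)
  have "(LINT t|lebesgue. (cmod (f t - g t))\<^sup>2) = enn2real (L2_dist_sq f g)"
    unfolding L2_dist_sq_def by (rule integral_eq_nn_integral) auto
  also have "\<dots> < \<epsilon>\<^sup>2"
    using close by (metis enn2real_less_iff ennreal_less_top order_less_trans zero_le_power2 enn2real_ennreal enn2real_less_iff infinity_ennreal_def top.not_eq_extremum)
  finally have "sqrt (LINT t|lebesgue. (cmod (f t - g t))\<^sup>2) < sqrt (\<epsilon>\<^sup>2)" by (rule real_sqrt_less_mono)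
  then have "L2_norm (\<lambda>t. f t - (\<Sum>i\<in>I. c i * dyadic_family wavelet i t)) < \<epsilon>"
    using \<open>0 < \<epsilon>\<close> by (simp add: L2_norm_def g_eq)
  then show "\<exists>I c. finite I \<and> L2_norm (\<lambda>t. f t - (\<Sum>i\<in>I. c i * dyadic_family wavelet i t)) < \<epsilon>"
    using I by blast
qed (simp_all add: dyadic_family_in_L2 dyadic_family_orthonormal)

lemma L2_fourier_wavelet: "L2_fourier wavelet (wavelet_hat (0, 0))"
  unfolding L2_fourier_def
proof (intro conjI)
  show "wavelet \<in> L2_fun" using dyadic_family_in_L2[of "(0, 0)"] by (simp add: dyadic_family_zero)
  have h: "test_function (wavelet_hat (0, 0))" by (rule test_function_wavelet_hat)
  show "wavelet_hat (0, 0) \<in> L2_fun"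
    using borel_measurable_lebesgue[OF test_function_measurable[OF h]] test_function_square_integrable[OF h] test_function_measurable[OF h]
    by (simp add: L2_fun_def integrable_completion)
  have "truncated_fourier R wavelet s = fourier (\<lambda>t. indicator {-R..R} t *\<^sub>R fourier (wavelet_hat (0, 0)) (- t)) s" for R s
  proof -
    have "(LINT t:{-R..R}|lebesgue. exp (- (\<i> * complex_of_real (s * t))) * wavelet t) =
      (LINT t|lborel. indicator {-R..R} t *\<^sub>R (exp (- (\<i> * complex_of_real (s * t))) * wavelet t))"
      unfolding set_lebesgue_integral_def by (rule integral_completion) measurable
    also have "\<dots> = (LINT t|lborel. cis (- (t * s)) * (indicator {-R..R} t *\<^sub>R wavelet t))"
      by (intro Bochner_Integration.integral_cong) (simp_all add: cis_conv_exp mult.commute)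
    finally show ?thesis by (simp add: truncated_fourier_def fourier_def wavelet_def wavelet_hat_zero)
  qed
  then show "((\<lambda>R. \<integral>\<^sup>+ s. ennreal ((cmod (truncated_fourier R wavelet s - wavelet_hat (0, 0) s))\<^sup>2) \<partial>lebesgue) \<longlongrightarrow> 0) at_top"
    using Fourier_inversion_L2[OF h] by (simp only: L2_dist_sq_def)
qed

theorem wavelet_set_tile: "wavelet_set E"
  unfolding wavelet_set_def
proof (intro conjI exI)
  show "E \<in> sets lebesgue" by simp
  show "L2_fourier wavelet (\<lambda>s. complex_of_real (1 / sqrt (2 * pi) * indicator E s))"
    using L2_fourier_wavelet unfolding wavelet_hat_zero .
  have mem: "wavelet \<in> L2_fun" using dyadic_family_in_L2[of "(0, 0)"] by (simp add: dyadic_family_zero)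
  have "complex_of_real (LINT t|lebesgue. (cmod (wavelet t))\<^sup>2) = L2_inner wavelet wavelet"
    unfolding L2_inner_def integral_complex_of_real[symmetric] by (simp only: complex_norm_square)
  also have "\<dots> = 1" using dyadic_family_orthonormal[of "(0, 0)" "(0, 0)"] by (simp add: dyadic_family_zero)
  finally have "L2_norm wavelet = 1" by (simp add: L2_norm_def)
  with mem show "orthonormal_wavelet wavelet"
    by (simp add: orthonormal_wavelet_def orthonormal_basis_dyadic_family)
qed

end

section \<open>The sets J tile by translations and by dilations\<close>

text \<open>
In the first case \<open>n\<close> is the least integer not below \<open>log 2 (a / s)\<close>, in the second one the least
integer above it. Reflecting an interval in zero exchanges the two forms.
\<close>

lemma dyadic_interval_tiles:
  fixes a s :: real
  assumes "0 < a" "0 < s"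
  shows "\<exists>!n::int. 2 powi n * s \<in> {a..<2 * a}" "\<exists>!n::int. 2 powi n * s \<in> {a<..2 * a}"
proof -
  let ?L = "log 2 (a / s)"
  have log: "log 2 (2 powi n) = real_of_int n" for n
    using powr_real_of_int'[of 2 n] log_powr_cancel[of 2 "real_of_int n"] by simp
  have le: "a \<le> 2 powi n * s \<longleftrightarrow> ?L \<le> real_of_int n" "2 powi n * s \<le> a \<longleftrightarrow> real_of_int n \<le> ?L" for n
  proof -
    have "a \<le> 2 powi n * s \<longleftrightarrow> a / s \<le> 2 powi n" "2 powi n * s \<le> a \<longleftrightarrow> 2 powi n \<le> a / s"
      using assms by (simp_all add: field_simps)
    then show "a \<le> 2 powi n * s \<longleftrightarrow> ?L \<le> real_of_int n" "2 powi n * s \<le> a \<longleftrightarrow> real_of_int n \<le> ?L"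
      using assms log_le_cancel_iff[of 2 "a / s" "2 powi n"] log_le_cancel_iff[of 2 "2 powi n" "a / s"]
      by (simp_all add: log)
  qed
  have half: "2 powi (n - 1) * s = 2 powi n * s / 2" for n
    by (simp add: power_int_diff)
  have "2 powi n * s \<in> {a..<2 * a} \<longleftrightarrow> \<lceil>?L\<rceil> = n" for n
  proof -
    have "2 powi n * s \<in> {a..<2 * a} \<longleftrightarrow> a \<le> 2 powi n * s \<and> \<not> a \<le> 2 powi (n - 1) * s"
      unfolding half by auto
    also have "\<dots> \<longleftrightarrow> \<lceil>?L\<rceil> = n" unfolding le by (auto simp: ceiling_eq_iff)
    finally show ?thesis .
  qed
  then show "\<exists>!n::int. 2 powi n * s \<in> {a..<2 * a}" by auto
  have "2 powi n * s \<in> {a<..2 * a} \<longleftrightarrow> \<lfloor>?L\<rfloor> + 1 = n" for n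
  proof -
    have "2 powi n * s \<in> {a<..2 * a} \<longleftrightarrow> \<not> 2 powi n * s \<le> a \<and> 2 powi (n - 1) * s \<le> a"
      unfolding half by auto
    also have "\<dots> \<longleftrightarrow> \<lfloor>?L\<rfloor> + 1 = n" unfolding le by (simp add: floor_eq_iff) linarith
    finally show ?thesis .
  qed
  then show "\<exists>!n::int. 2 powi n * s \<in> {a<..2 * a}" by auto
qed

lemma J_mem_iff: "x \<in> J \<beta> \<longleftrightarrow>
  - (32 * pi / 7) \<le> x \<and> x < - 4 * pi + 4 * \<beta> \<or> - pi + \<beta> \<le> x \<and> x < - (4 * pi / 7) \<or>
  4 * pi / 7 \<le> x \<and> x < pi + \<beta> \<or> 4 * pi + 4 * \<beta> \<le> x \<and> x < 4 * pi + 4 * pi / 7"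
  by (auto simp: J_def)

context
  fixes \<beta> :: real
  assumes \<beta>: "- (pi / 7) \<le> \<beta>" "\<beta> \<le> pi / 7"
begin

text \<open>
Modulo \<open>2\<pi>\<close>, the four intervals that make up \<open>J \<beta>\<close>, in increasing order, are the pieces
\<open>[-4\<pi>/7, 4\<beta>)\<close>, \<open>[\<pi> + \<beta>, 10\<pi>/7)\<close>, \<open>[4\<pi>/7, \<pi> + \<beta>)\<close> and \<open>[4\<beta>, 4\<pi>/7)\<close> of
\<open>[-4\<pi>/7, 10\<pi>/7)\<close>.
\<close>

lemma J_translate_iff:
  fixes j :: int
  assumes y: "y \<in> {- (4 * pi / 7)..<- (4 * pi / 7) + 2 * pi}"
  shows "y + 2 * pi * of_int j \<in> J \<beta> \<longleftrightarrow>
    j = (if y < 4 * \<beta> then - 2 else if y < 4 * pi / 7 then 2 else if y < pi + \<beta> then 0 else - 1)"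
proof
  assume J: "y + 2 * pi * of_int j \<in> J \<beta>"
  then have "2 * pi * (- 3) < 2 * pi * of_int j" "2 * pi * of_int j < 2 * pi * 3"
    using y \<beta> pi_gt_zero unfolding J_mem_iff atLeastLessThan_iff by argo+
  from this[THEN mult_left_less_imp_less] have "- 3 < real_of_int j" "real_of_int j < 3" by simp_all
  \<comment> \<open>Comparing the extreme points of the interval and of \<open>J \<beta>\<close> leaves finitely many shifts.\<close>
  then have "j \<in> {-2, -1, 0, 1, 2}" by auto
  then show "j = (if y < 4 * \<beta> then - 2 else if y < 4 * pi / 7 then 2 else if y < pi + \<beta> then 0 else - 1)"
    using J y \<beta> pi_gt_zero unfolding J_mem_iff atLeastLessThan_iff by auto
next
  assume "j = (if y < 4 * \<beta> then - 2 else if y < 4 * pi / 7 then 2 else if y < pi + \<beta> then 0 else - 1)"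
  then show "y + 2 * pi * of_int j \<in> J \<beta>"
    using y \<beta> pi_gt_zero unfolding J_mem_iff atLeastLessThan_iff by (auto split: if_splits)
qed

lemma J_translation_tiles: "\<exists>!k::int. x + 2 * pi * of_int k \<in> J \<beta>"
proof -
  let ?P = "{- (4 * pi / 7)..<- (4 * pi / 7) + 2 * pi}"
  obtain k\<^sub>0 :: int where k\<^sub>0: "x + 2 * pi * of_int k\<^sub>0 \<in> ?P" using interval_tiles[of x "- (4 * pi / 7)"] by blast
  obtain e where e: "\<And>j::int. x + 2 * pi * of_int k\<^sub>0 + 2 * pi * of_int j \<in> J \<beta> \<longleftrightarrow> j = e"
    using J_translate_iff[OF k\<^sub>0] by blast
  have "x + 2 * pi * of_int k \<in> J \<beta> \<longleftrightarrow> k = k\<^sub>0 + e" for k :: int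
    using e[of "k - k\<^sub>0"] by (auto simp: algebra_simps)
  then show ?thesis by simp
qed

text \<open>
A quarter of the last interval of \<open>J \<beta>\<close> is \<open>[\<pi> + \<beta>, 8\<pi>/7)\<close>, which together with the third
interval fills \<open>[4\<pi>/7, 8\<pi>/7)\<close>; similarly a quarter of the first interval and the second interval
fill \<open>[-8\<pi>/7, -4\<pi>/7)\<close>.
\<close>

lemma J_dilation_tiles:
  assumes "s \<noteq> 0"
  shows "\<exists>!n::int. 2 powi n * s \<in> J \<beta>"
proof -
  have quarter: "2 powi (n - 2) * s = 2 powi n * s / 4" for n :: int
    by (simp add: power_int_diff)
  have "\<exists>m::int. \<forall>n. 2 powi n * s \<in> J \<beta> \<longleftrightarrow> n = m"
  proof (cases "0 < s")
    case True
    let ?I = "{4 * pi / 7..<2 * (4 * pi / 7)}"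
    obtain n\<^sub>0 :: int where n\<^sub>0: "\<And>n. 2 powi n * s \<in> ?I \<longleftrightarrow> n = n\<^sub>0"
      using dyadic_interval_tiles(1)[of "4 * pi / 7" s] True by (metis divide_pos_pos mult_pos_pos pi_gt_zero zero_less_numeral)
    have J: "2 powi n * s \<in> J \<beta> \<longleftrightarrow>
        2 powi n * s \<in> ?I \<and> 2 powi n * s < pi + \<beta> \<or>
        2 powi (n - 2) * s \<in> ?I \<and> \<not> 2 powi (n - 2) * s < pi + \<beta>" for n
    proof -
      have "0 < 2 powi n * s" using True by simp
      then show ?thesis
        using \<beta> pi_gt_zero unfolding J_mem_iff quarter atLeastLessThan_iff by argo
    qed
    show ?thesis
    proof (cases "2 powi n\<^sub>0 * s < pi + \<beta>")
      case True
      then show ?thesis unfolding J n\<^sub>0 by (intro exI[of _ n\<^sub>0]) auto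
    next
      case False
      then show ?thesis unfolding J n\<^sub>0 by (intro exI[of _ "n\<^sub>0 + 2"]) auto
    qed
  next
    case False
    let ?I = "{4 * pi / 7<..2 * (4 * pi / 7)}"
    have "0 < - s" using False assms by simp
    then obtain n\<^sub>0 :: int where n\<^sub>0: "\<And>n. 2 powi n * (- s) \<in> ?I \<longleftrightarrow> n = n\<^sub>0"
      using dyadic_interval_tiles(2)[of "4 * pi / 7" "- s"] by (metis divide_pos_pos mult_pos_pos pi_gt_zero zero_less_numeral)
    have J: "2 powi n * s \<in> J \<beta> \<longleftrightarrow>
        2 powi n * (- s) \<in> ?I \<and> \<not> 2 powi n * s < - pi + \<beta> \<or>
        2 powi (n - 2) * (- s) \<in> ?I \<and> 2 powi (n - 2) * s < - pi + \<beta>" for n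
    proof -
      have "2 powi n * s < 0" using False assms by (simp add: mult_less_0_iff)
      then show ?thesis
        using \<beta> pi_gt_zero unfolding J_mem_iff mult_minus_right quarter greaterThanAtMost_iff by argo
    qed
    show ?thesis
    proof (cases "2 powi n\<^sub>0 * s < - pi + \<beta>")
      case True
      then show ?thesis unfolding J n\<^sub>0 by (intro exI[of _ "n\<^sub>0 + 2"]) auto
    next
      case False
      then show ?thesis unfolding J n\<^sub>0 by (intro exI[of _ n\<^sub>0]) auto
    qed
  qed
  then show ?thesis by auto
qed

lemma zero_notin_J: "0 \<notin> J \<beta>"
  using \<beta> pi_gt_zero unfolding J_mem_iff by argo

lemma wavelet_tile_J: "wavelet_tile (J \<beta>)"
proof unfold_locales
  show "J \<beta> \<in> sets borel" by (simp add: J_def)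
  have sub: "frontier (J \<beta>) \<subseteq> frontier {- (32 * pi / 7)..<- 4 * pi + 4 * \<beta>} \<union> frontier {- pi + \<beta>..<- (4 * pi / 7)}
    \<union> frontier {4 * pi / 7..<pi + \<beta>} \<union> frontier {4 * pi + 4 * \<beta>..<4 * pi + 4 * pi / 7}"
    unfolding J_def by (meson Un_mono frontier_Un_subset order_refl order_trans)
  have "AE x in lborel. x \<notin> frontier {- (32 * pi / 7)..<- 4 * pi + 4 * \<beta>} \<and> x \<notin> frontier {- pi + \<beta>..<- (4 * pi / 7)}
    \<and> x \<notin> frontier {4 * pi / 7..<pi + \<beta>} \<and> x \<notin> frontier {4 * pi + 4 * \<beta>..<4 * pi + 4 * pi / 7}"
    by (intro AE_conjI AE_not_in_frontier_interval)
  then show "AE x in lborel. x \<notin> frontier (J \<beta>)"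
    by (rule eventually_mono) (use sub in blast)
qed (simp_all add: J_translation_tiles J_dilation_tiles zero_notin_J)

end

section \<open>The interpolation map is an involution\<close>

text \<open>
How the interpolation map is evaluated: every \<open>s \<noteq> 0\<close> has the form \<open>2 powi n * x\<close> with \<open>x \<in> E\<close>.
\<close>

lemma interpolation_map_eq:
  assumes dil: "\<And>s. s \<noteq> 0 \<Longrightarrow> \<exists>!n::int. 2 powi n * s \<in> E" and tr: "\<exists>!k::int. x + 2 * pi * of_int k \<in> F"
    and x: "x \<in> E" "x \<noteq> 0" and y: "x + 2 * pi * of_int k \<in> F"
  shows "interpolation_map E F (2 powi n * x) = 2 powi n * (x + 2 * pi * of_int k)"
proof -
  have mem: "2 powi n * x \<in> (\<lambda>z. 2 powi m * z) ` E \<longleftrightarrow> 2 powi (n - m) * x \<in> E" for m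
  proof -
    have "2 powi n * x = 2 powi m * z \<longleftrightarrow> z = 2 powi (n - m) * x" for z :: real
      by (auto simp: power_int_diff)
    then show ?thesis by (auto simp: image_iff)
  qed
  have "dilation_exponent E (2 powi n * x) = n"
    unfolding dilation_exponent_def mem
  proof (rule the_equality)
    fix m :: int assume "2 powi (n - m) * x \<in> E"
    moreover have "2 powi 0 * x \<in> E" using x by simp
    ultimately have "n - m = 0" using dil[OF x(2)] by blast
    then show "m = n" by simp
  qed (use x in simp)
  moreover have "2 powi (- n) * (2 powi n * x) = x" by (simp add: power_int_minus)
  moreover have "2 powi n * x \<noteq> 0" using x by simp
  ultimately show ?thesis
    by (simp only: interpolation_map_def translation_rep_eqI[OF tr y] if_False)
qed

text \<open>
The image \<open>y = x + 2\<pi>k\<close> of \<open>x\<close> is \<open>2^m z\<close> with \<open>z \<in> E = J \<beta>\<^sub>1\<close>, and the translation that takes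
\<open>z\<close> to \<open>F = J \<beta>\<^sub>2\<close>, scaled by \<open>2^m\<close>, brings \<open>y\<close> back to \<open>x\<close>. Away from \<open>F\<close> the pair of
translations is \<open>(2\<pi>, -8\<pi>)\<close>, \<open>(-8\<pi>, 2\<pi>)\<close> or one of their negatives.
\<close>

lemma J_interpolation_step:
  assumes \<beta>: "- (pi / 7) \<le> \<beta>\<^sub>1" "\<beta>\<^sub>1 \<le> pi / 7" "- (pi / 7) \<le> \<beta>\<^sub>2" "\<beta>\<^sub>2 \<le> pi / 7" and x: "x \<in> J \<beta>\<^sub>1"
  obtains k j m :: int and z where
    "x + 2 * pi * of_int k \<in> J \<beta>\<^sub>2" "z \<in> J \<beta>\<^sub>1" "x + 2 * pi * of_int k = 2 powi m * z"
    "z + 2 * pi * of_int j \<in> J \<beta>\<^sub>2" "2 powi m * (z + 2 * pi * of_int j) = x"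
proof -
  consider (same) "x \<in> J \<beta>\<^sub>2"
    | (a) "- pi + \<beta>\<^sub>1 \<le> x" "x < - pi + \<beta>\<^sub>2"
    | (b) "4 * pi + 4 * \<beta>\<^sub>1 \<le> x" "x < 4 * pi + 4 * \<beta>\<^sub>2"
    | (c) "- 4 * pi + 4 * \<beta>\<^sub>2 \<le> x" "x < - 4 * pi + 4 * \<beta>\<^sub>1"
    | (d) "pi + \<beta>\<^sub>2 \<le> x" "x < pi + \<beta>\<^sub>1"
    using x unfolding J_mem_iff by argo
  then show ?thesis
  proof cases
    case same
    show ?thesis by (rule that[of 0 x 0 0]) (use x same in simp_all)
  next
    case a
    show ?thesis
      by (rule that[of 1 "4 * (x + 2 * pi)" "- 2" "- 4"])
        (use a \<beta> pi_gt_zero in \<open>auto simp: J_mem_iff power_int_minus algebra_simps\<close>)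
  next
    case b
    show ?thesis
      by (rule that[of "- 4" "x / 4 - 2 * pi" 2 1])
        (use b \<beta> pi_gt_zero in \<open>auto simp: J_mem_iff power_int_minus algebra_simps\<close>)
  next
    case c
    show ?thesis
      by (rule that[of 4 "x / 4 + 2 * pi" 2 "- 1"])
        (use c \<beta> pi_gt_zero in \<open>auto simp: J_mem_iff power_int_minus algebra_simps\<close>)
  next
    case d
    show ?thesis
      by (rule that[of "- 1" "4 * (x - 2 * pi)" "- 2" 4])
        (use d \<beta> pi_gt_zero in \<open>auto simp: J_mem_iff power_int_minus algebra_simps\<close>)
  qed
qed

lemma J_interpolation_involution:
  assumes \<beta>: "- (pi / 7) \<le> \<beta>\<^sub>1" "\<beta>\<^sub>1 \<le> pi / 7" "- (pi / 7) \<le> \<beta>\<^sub>2" "\<beta>\<^sub>2 \<le> pi / 7"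
  shows "interpolation_map (J \<beta>\<^sub>1) (J \<beta>\<^sub>2) (interpolation_map (J \<beta>\<^sub>1) (J \<beta>\<^sub>2) s) = s"
proof (cases "s = 0")
  case True
  then show ?thesis by (simp add: interpolation_map_def)
next
  case False
  let ?\<sigma> = "interpolation_map (J \<beta>\<^sub>1) (J \<beta>\<^sub>2)"
  note dil = J_dilation_tiles[OF \<beta>(1,2)] and tr = J_translation_tiles[OF \<beta>(3,4)]
  have nz: "x \<in> J \<beta>\<^sub>1 \<Longrightarrow> x \<noteq> 0" for x using zero_notin_J[OF \<beta>(1,2)] by blast
  have \<sigma>: "?\<sigma> (2 powi i * u) = 2 powi i * (u + 2 * pi * of_int l)"
    if "u \<in> J \<beta>\<^sub>1" "u + 2 * pi * of_int l \<in> J \<beta>\<^sub>2" for i l :: int and u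
    by (rule interpolation_map_eq[OF _ tr that(1) nz[OF that(1)] that(2)]) (rule dil)
  obtain n :: int where n: "2 powi n * s \<in> J \<beta>\<^sub>1" using dil[OF False] by blast
  define x where "x = 2 powi n * s"
  have x: "x \<in> J \<beta>\<^sub>1" and s: "s = 2 powi (- n) * x" using n by (simp_all add: x_def power_int_minus)
  obtain k j m :: int and z where y: "x + 2 * pi * of_int k \<in> J \<beta>\<^sub>2" and z: "z \<in> J \<beta>\<^sub>1"
    "x + 2 * pi * of_int k = 2 powi m * z" "z + 2 * pi * of_int j \<in> J \<beta>\<^sub>2" "2 powi m * (z + 2 * pi * of_int j) = x"
    using J_interpolation_step[OF \<beta> x] by metis
  have "?\<sigma> s = 2 powi (- n) * (2 powi m * z)"
    using \<sigma>[OF x y, of "- n"] by (simp only: s z(2))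
  also have "\<dots> = 2 powi (- n + m) * z" by (simp add: power_int_add del: add_uminus_conv_diff uminus_add_conv_diff)
  finally have "?\<sigma> (?\<sigma> s) = 2 powi (- n + m) * (z + 2 * pi * of_int j)"
    using \<sigma>[OF z(1,3), of "- n + m"] by (simp only:)
  also have "\<dots> = 2 powi (- n) * (2 powi m * (z + 2 * pi * of_int j))" by (simp add: power_int_add del: add_uminus_conv_diff uminus_add_conv_diff)
  finally show ?thesis by (simp only: z(4) s)
qed

theorem proposition5p4:
  fixes \<beta>\<^sub>1 \<beta>\<^sub>2 :: real
  assumes "\<beta>\<^sub>1 \<in> {- (pi / 7) .. pi / 7}" and "\<beta>\<^sub>2 \<in> {- (pi / 7) .. pi / 7}"
  shows "interpolation_pair (J \<beta>\<^sub>1) (J \<beta>\<^sub>2)"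
proof -
  have \<beta>: "- (pi / 7) \<le> \<beta>\<^sub>1" "\<beta>\<^sub>1 \<le> pi / 7" "- (pi / 7) \<le> \<beta>\<^sub>2" "\<beta>\<^sub>2 \<le> pi / 7" using assms by auto
  show ?thesis
    unfolding interpolation_pair_def
    using wavelet_tile.wavelet_set_tile[OF wavelet_tile_J[OF \<beta>(1,2)]]
      wavelet_tile.wavelet_set_tile[OF wavelet_tile_J[OF \<beta>(3,4)]] J_interpolation_involution[OF \<beta>]
    by simp
qed

end
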